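(* Let $G$ be a finite simple graph with at least one vertex. For each $v \in V(G)$, let $c(v)$ be the maximum length of a cycle of $G$ containing $v$, and set $c(v)=2$ if $v$ lies on no cycle. Let $u \in V(G)$ be a vertex with $c(u) = \max\{c(v) : v \in V(G)\}$ (so $c(u)$ is the circumference of $G$ when $G$ has a cycle). Then \[ |E(G)| \le \left(\sum_{v \in V(G)} \frac{c(v)}{2}\right) - \frac{c(u)}{2}, \] and equality holds if and only if $G$ is a parent-dominated block graph.
   Context: A block of a graph is a maximal connected subgraph without cut vertices. A block graph is a connected graph in which every block is a clique. For a block graph $G$, consider its block tree (the tree whose nodes are the blocks of $G$, with the tree structure given by how blocks meet at cut vertices, i.e. the block–cut-vertex tree with blocks as the nodes of interest). Rooting this tree at a block gives each non-root block $B$ a parent block: the block adjacent to $B$ (sharing the cut vertex of $B$ closest to the root) on the way to the root. A block graph $G$ is a parent-dominated block graph if its block tree can be rooted at a block of largest order (number of vertices) such that every non-root block has order at most the order of its parent block. *)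

theory Defs
  imports Complex_Main
begin

record 'a sgraph =
  verts :: "'a set"
  edges :: "'a set set"

definition simple_graph :: "'a sgraph \<Rightarrow> bool" where
  "simple_graph G \<longleftrightarrow> (\<forall>e\<in>edges G. e \<subseteq> verts G \<and> card e = 2)"

definition adj :: "'a sgraph \<Rightarrow> 'a \<Rightarrow> 'a \<Rightarrow> bool" where
  "adj G x y \<longleftrightarrow> {x, y} \<in> edges G"

definition subgraph :: "'a sgraph \<Rightarrow> 'a sgraph \<Rightarrow> bool" where
  "subgraph H G \<longleftrightarrow> simple_graph H \<and> verts H \<subseteq> verts G \<and> edges H \<subseteq> edges G"

text \<open>The graph without vertices does not count as connected.\<close>

definition connected_graph :: "'a sgraph \<Rightarrow> bool" where
  "connected_graph G \<longleftrightarrow>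
     verts G \<noteq> {} \<and> (\<forall>x\<in>verts G. \<forall>y\<in>verts G. (adj G)\<^sup>*\<^sup>* x y)"

definition del_vertex :: "'a sgraph \<Rightarrow> 'a \<Rightarrow> 'a sgraph" where
  "del_vertex G v = \<lparr>verts = verts G - {v}, edges = {e \<in> edges G. v \<notin> e}\<rparr>"

text \<open>A cut vertex separates two other vertices of its component; equivalently, its deletion
  increases the number of components.\<close>

definition cut_vertex :: "'a sgraph \<Rightarrow> 'a \<Rightarrow> bool" where
  "cut_vertex G v \<longleftrightarrow> v \<in> verts G \<and>
     (\<exists>x\<in>verts G - {v}. \<exists>y\<in>verts G - {v}.
        (adj G)\<^sup>*\<^sup>* x y \<and> \<not> (adj (del_vertex G v))\<^sup>*\<^sup>* x y)"

text \<open>The absence of cut vertices concerns cut vertices of the subgraph itself, not of the ambient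
  graph. An isolated vertex and a bridge (with its two ends) are blocks.\<close>

definition nonseparable :: "'a sgraph \<Rightarrow> bool" where
  "nonseparable H \<longleftrightarrow> connected_graph H \<and> (\<nexists>v. cut_vertex H v)"

definition block :: "'a sgraph \<Rightarrow> 'a sgraph \<Rightarrow> bool" where
  "block G B \<longleftrightarrow> subgraph B G \<and> nonseparable B \<and>
     (\<forall>H. subgraph H G \<and> nonseparable H \<and> subgraph B H \<longrightarrow> H = B)"

definition complete_graph :: "'a sgraph \<Rightarrow> bool" where
  "complete_graph G \<longleftrightarrow> (\<forall>x\<in>verts G. \<forall>y\<in>verts G. x \<noteq> y \<longrightarrow> adj G x y)"

definition block_graph :: "'a sgraph \<Rightarrow> bool" where
  "block_graph G \<longleftrightarrow> connected_graph G \<and> (\<forall>B. block G B \<longrightarrow> complete_graph B)"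

text \<open>The block--cut-vertex tree: \<open>Inl\<close> nodes are blocks, \<open>Inr\<close> nodes are cut vertices.\<close>

definition block_tree :: "'a sgraph \<Rightarrow> ('a sgraph + 'a) sgraph" where
  "block_tree G =
     \<lparr>verts = Inl ` {B. block G B} \<union> Inr ` {v. cut_vertex G v},
      edges = {{Inl B, Inr v} | B v. block G B \<and> cut_vertex G v \<and> v \<in> verts B}\<rparr>"

definition path :: "'a sgraph \<Rightarrow> 'a list \<Rightarrow> bool" where
  "path G p \<longleftrightarrow> p \<noteq> [] \<and> set p \<subseteq> verts G \<and> distinct p \<and> successively (adj G) p"

text \<open>In the tree \<open>T\<close> rooted at \<open>r\<close>, the parent of \<open>x\<close> is the second node of the path
  from \<open>x\<close> to \<open>r\<close>. A parent of a block in the block--cut-vertex tree is a cut vertex, so its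
  parent block is two steps up.\<close>

definition tree_parent :: "'a sgraph \<Rightarrow> 'a \<Rightarrow> 'a \<Rightarrow> 'a \<Rightarrow> bool" where
  "tree_parent T r x y \<longleftrightarrow> (\<exists>p. path T (x # y # p) \<and> last (x # y # p) = r)"

definition parent_block :: "'a sgraph \<Rightarrow> 'a sgraph \<Rightarrow> 'a sgraph \<Rightarrow> 'a sgraph \<Rightarrow> bool" where
  "parent_block G R B P \<longleftrightarrow>
     (\<exists>v. tree_parent (block_tree G) (Inl R) (Inl B) (Inr v) \<and>
          tree_parent (block_tree G) (Inl R) (Inr v) (Inl P))"

definition parent_dominated_block_graph :: "'a sgraph \<Rightarrow> bool" where
  "parent_dominated_block_graph G \<longleftrightarrow> block_graph G \<and>
     (\<exists>R. block G R \<and>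
          (\<forall>B. block G B \<longrightarrow> card (verts B) \<le> card (verts R)) \<and>
          (\<forall>B. block G B \<and> B \<noteq> R \<longrightarrow>
             (\<exists>P. parent_block G R B P \<and> card (verts B) \<le> card (verts P))))"

text \<open>A cycle is listed without repeating its first vertex, so its length is the length of the
  list.\<close>

definition cycle :: "'a sgraph \<Rightarrow> 'a list \<Rightarrow> bool" where
  "cycle G p \<longleftrightarrow> path G p \<and> 3 \<le> length p \<and> adj G (last p) (hd p)"

definition max_cycle_length :: "'a sgraph \<Rightarrow> 'a \<Rightarrow> nat" where
  "max_cycle_length G v =
     (if \<exists>p. cycle G p \<and> v \<in> set p
      then Max {length p | p. cycle G p \<and> v \<in> set p} else 2)"

end

theory Submission imports Defs begin

text \<open>For every vertex \<open>u\<close> of \<open>G\<close> we have \<open>2 |E(G)| \<le> \<Sum>v \<noteq> u. c(v)\<close>, by induction on the number of vertices.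
  Among the longest paths \<open>x\<^sub>0 \<dots> x\<^sub>m\<close> ending in \<open>u\<close> let \<open>K\<close> be the largest index of a neighbour of \<open>x\<^sub>0\<close>;
  then \<open>C = {x\<^sub>0, \<dots>, x\<^sub>K}\<close> spans a cycle (or an edge). Among the longest paths to \<open>u\<close> that start by
  traversing \<open>C\<close>, take one whose first vertex has maximum degree \<open>d\<close>. The \<open>d\<close> predecessors \<open>S\<close> of the
  neighbours of its first vertex are first vertices of rotated paths of the same kind, so they have
  degree at most \<open>d\<close> and all their neighbours in \<open>C\<close>. Hence \<open>S\<close> meets at most
  \<open>(d\<^sup>2 + d (|C| - d)) / 2 = |S| |C| / 2\<close> edges, and \<open>S\<close> can be deleted.

  If equality holds then \<open>S\<close> is completely joined to \<open>C - S\<close>. By induction \<open>G - S\<close> arises from \<open>u\<close> by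
  attaching cliques; any two vertices of \<open>C - S\<close> would be joined in it by a path with at least \<open>|C|\<close>
  vertices, which a vertex of \<open>S\<close> closes to a cycle that is too long. So \<open>|C - S| = 1\<close> and \<open>C\<close> is a pendant
  clique. Conversely, in a parent-dominated block graph, adding the blocks in order of decreasing
  size, each one meeting the earlier ones, gives \<open>\<Sum>v. c(v) \<le> 2 |E(G)| + c(u)\<close>.\<close>

section \<open>Adjacency, reachability and paths\<close>

lemma adj_commute: "adj G x y \<longleftrightarrow> adj G y x"
  by (simp add: adj_def insert_commute)

lemma simple_adjD:
  assumes "simple_graph G" "adj G x y"
  shows "x \<in> verts G" "y \<in> verts G" "x \<noteq> y"
proof -
  have "{x, y} \<subseteq> verts G" "card {x, y} = 2" using assms by (auto simp: simple_graph_def adj_def)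
  then show "x \<in> verts G" "y \<in> verts G" "x \<noteq> y" by auto
qed

lemma finite_edges: "simple_graph G \<Longrightarrow> finite (verts G) \<Longrightarrow> finite (edges G)"
  by (rule finite_subset[of _ "Pow (verts G)"]) (auto simp: simple_graph_def)

lemma edge_adjE:
  assumes "simple_graph G" "e \<in> edges G"
  obtains x y where "e = {x, y}" "x \<noteq> y" "adj G x y"
  using assms by (metis adj_def card_2_iff simple_graph_def)

lemma reach_sym: "(adj G)\<^sup>*\<^sup>* x y \<Longrightarrow> (adj G)\<^sup>*\<^sup>* y x"
proof -
  assume "(adj G)\<^sup>*\<^sup>* x y"
  moreover have "symp (adj G)" using adj_commute by (metis sympI)
  ultimately show ?thesis using symp_rtranclp by (metis sympD)
qed

lemma reach_mono:
  assumes "(adj G)\<^sup>*\<^sup>* x y" "edges G \<subseteq> edges H"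
  shows "(adj H)\<^sup>*\<^sup>* x y"
proof -
  have "adj G \<le> adj H" using assms(2) by (auto simp: adj_def)
  then show ?thesis using assms(1) rtranclp_mono by blast
qed

lemma adj_del_vertex: "adj (del_vertex G v) x y \<longleftrightarrow> adj G x y \<and> x \<noteq> v \<and> y \<noteq> v"
  by (auto simp: adj_def del_vertex_def)

lemma simple_del_vertex: "simple_graph G \<Longrightarrow> simple_graph (del_vertex G v)"
  by (auto simp: simple_graph_def del_vertex_def)

lemma path_reach: "successively (adj G) p \<Longrightarrow> p \<noteq> [] \<Longrightarrow> (adj G)\<^sup>*\<^sup>* (hd p) (last p)"
proof (induction p rule: induct_list012)
  case (3 x y zs)
  then show ?case by (auto intro: converse_rtranclp_into_rtranclp)
qed auto

lemma path_append1: "path G (xs @ ys) \<Longrightarrow> xs \<noteq> [] \<Longrightarrow> path G xs"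
  by (auto simp: path_def successively_append_iff)

lemma path_append2: "path G (xs @ ys) \<Longrightarrow> ys \<noteq> [] \<Longrightarrow> path G ys"
  by (auto simp: path_def successively_append_iff)

lemma path_Cons:
  "p \<noteq> [] \<Longrightarrow> path G (x # p) \<longleftrightarrow> x \<in> verts G \<and> x \<notin> set p \<and> adj G x (hd p) \<and> path G p"
  by (cases p) (auto simp: path_def)

text \<open>When a step from \<open>x\<close> leads to a path already containing \<open>x\<close>,
  only the suffix starting at \<open>x\<close> is kept, so the list stays distinct.\<close>

lemma reach_imp_path:
  assumes "(adj G)\<^sup>*\<^sup>* x y" "simple_graph G" "x \<in> verts G"
  shows "\<exists>p. path G p \<and> hd p = x \<and> last p = y"
  using assms
proof (induction rule: converse_rtranclp_induct)
  case base
  then show ?case by (intro exI[of _ "[y]"]) (auto simp: path_def)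
next
  case (step x z)
  then obtain p where p: "path G p" "hd p = z" "last p = y" by (meson simple_adjD)
  have ne: "p \<noteq> []" using p by (auto simp: path_def)
  show ?case
  proof (cases "x \<in> set p")
    case True
    then obtain as bs where "p = as @ x # bs" by (meson split_list)
    then show ?thesis using p path_append2[of G as "x # bs"]
      by (intro exI[of _ "x # bs"]) auto
  next
    case False
    then show ?thesis using p ne step
      by (intro exI[of _ "x # p"]) (auto simp: path_Cons)
  qed
qed

lemma path_length_le: "path G p \<Longrightarrow> finite (verts G) \<Longrightarrow> length p \<le> card (verts G)"
  by (metis card_mono distinct_card path_def)

lemma path_rev: "path G (rev p) \<longleftrightarrow> path G p"
proof -
  have "successively (\<lambda>x y. adj G y x) p = successively (adj G) p"
    by (intro successively_cong adj_commute refl)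
  then show ?thesis by (simp add: path_def)
qed

section \<open>Cliques and maximum cycle lengths\<close>

definition clique :: "'a sgraph \<Rightarrow> 'a set \<Rightarrow> bool" where
  "clique G K \<longleftrightarrow> K \<subseteq> verts G \<and> (\<forall>x\<in>K. \<forall>y\<in>K. x \<noteq> y \<longrightarrow> adj G x y)"

lemma clique_path: "clique G (set p) \<Longrightarrow> distinct p \<Longrightarrow> p \<noteq> [] \<Longrightarrow> path G p"
proof (induction p)
  case (Cons x p)
  show ?case
  proof (cases "p = []")
    case False
    then have "adj G x (hd p)" using Cons.prems unfolding clique_def
      by (metis distinct.simps(2) hd_in_set list.set_intros(1) list.set_intros(2))
    then show ?thesis using Cons False by (auto simp: path_Cons clique_def)
  qed (use Cons.prems in \<open>auto simp: path_def clique_def\<close>)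
qed auto

lemma finite_cycle_lengths:
  assumes "finite (verts G)" shows "finite {length p | p. cycle G p \<and> v \<in> set p}"
proof (rule finite_subset)
  show "{length p | p. cycle G p \<and> v \<in> set p} \<subseteq> {..card (verts G)}"
    using assms by (auto simp: cycle_def path_length_le)
qed auto

lemma cycle_length_le:
  assumes "finite (verts G)" "cycle G p" "v \<in> set p"
  shows "length p \<le> max_cycle_length G v"
proof -
  have "length p \<le> Max {length p | p. cycle G p \<and> v \<in> set p}"
    using finite_cycle_lengths[OF assms(1)] assms(2,3) by (intro Max_ge) auto
  then show ?thesis using assms(2,3) by (auto simp: max_cycle_length_def)
qed

lemma max_cycle_cases:
  assumes "finite (verts G)"
  obtains "max_cycle_length G v = 2" "\<nexists>p. cycle G p \<and> v \<in> set p"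
  | p where "cycle G p" "v \<in> set p" "length p = max_cycle_length G v"
proof (cases "\<exists>p. cycle G p \<and> v \<in> set p")
  case True
  then have "Max {length p | p. cycle G p \<and> v \<in> set p} \<in> {length p | p. cycle G p \<and> v \<in> set p}"
    using finite_cycle_lengths[OF assms] by (intro Max_in) auto
  then show ?thesis using True that(2) by (auto simp: max_cycle_length_def)
qed (use that(1) in \<open>auto simp: max_cycle_length_def\<close>)

lemma max_cycle_ge2: "finite (verts G) \<Longrightarrow> 2 \<le> max_cycle_length G v"
  by (rule max_cycle_cases[of G v]) (auto simp: cycle_def)

text \<open>The bound \<open>2 \<le> n\<close> absorbs the default value for a vertex on no
  cycle.\<close>

lemma max_cycle_leI:
  assumes "finite (verts G)" "2 \<le> n" "\<And>p. cycle G p \<Longrightarrow> v \<in> set p \<Longrightarrow> length p \<le> n"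
  shows "max_cycle_length G v \<le> n"
  by (rule max_cycle_cases[OF assms(1), of v]) (use assms in \<open>simp, metis\<close>)

lemma path_subgraph: "path H p \<Longrightarrow> subgraph H G \<Longrightarrow> path G p"
  by (auto simp: path_def subgraph_def adj_def elim!: successively_mono)

text \<open>A cycle of \<open>H\<close> is a cycle of \<open>G\<close>, and the default 2 is the
  least possible value in \<open>G\<close>.\<close>

lemma max_cycle_mono:
  assumes "subgraph H G" "finite (verts G)"
  shows "max_cycle_length H v \<le> max_cycle_length G v"
proof (rule max_cycle_leI)
  show "finite (verts H)" using assms by (auto simp: subgraph_def intro: finite_subset)
  fix p assume "cycle H p" "v \<in> set p"
  moreover from this have "cycle G p"
    using assms path_subgraph[of H p G] by (auto simp: cycle_def subgraph_def adj_def)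
  ultimately show "length p \<le> max_cycle_length G v" using assms by (intro cycle_length_le)
qed (simp add: assms max_cycle_ge2)

text \<open>Any enumeration of a clique closes up to a cycle as soon as there are three
  vertices.\<close>

lemma clique_max_cycle:
  assumes "clique G K" "finite (verts G)" "v \<in> K" "3 \<le> card K"
  shows "card K \<le> max_cycle_length G v"
proof -
  have "finite K" using assms by (auto simp: clique_def intro: finite_subset)
  then obtain p where p: "set p = K" "distinct p" using finite_distinct_list by blast
  then have len: "length p = card K" by (metis distinct_card)
  have ne: "p \<noteq> []" using p assms by auto
  moreover have "last p \<noteq> hd p"
  proof -
    obtain x y q where "p = x # y # q" using len assms(4)
      by (metis Suc_le_length_iff numeral_3_eq_3)
    then show ?thesis using p(2) by auto
  qed
  ultimately have "adj G (last p) (hd p)"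
    using assms(1) p(1) unfolding clique_def by (metis hd_in_set last_in_set)
  then have "cycle G p" using p len assms ne clique_path[of G p] by (auto simp: cycle_def)
  then show ?thesis using cycle_length_le[OF assms(2)] p len assms by metis
qed

definition del_verts :: "'a sgraph \<Rightarrow> 'a set \<Rightarrow> 'a sgraph" where
  "del_verts G S = \<lparr>verts = verts G - S, edges = {e \<in> edges G. e \<inter> S = {}}\<rparr>"

lemma verts_del_verts [simp]: "verts (del_verts G S) = verts G - S"
  by (simp add: del_verts_def)

lemma adj_del_verts: "adj (del_verts G S) x y \<longleftrightarrow> adj G x y \<and> x \<notin> S \<and> y \<notin> S"
  by (auto simp: adj_def del_verts_def)

lemma subgraph_del_verts: "simple_graph G \<Longrightarrow> subgraph (del_verts G S) G"
  by (auto simp: subgraph_def simple_graph_def del_verts_def)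

lemma simple_del_verts: "simple_graph G \<Longrightarrow> simple_graph (del_verts G S)"
  by (auto simp: simple_graph_def del_verts_def)

section \<open>Rotations of longest paths\<close>

abbreviation nbrs :: "'a sgraph \<Rightarrow> 'a \<Rightarrow> 'a set" where
  "nbrs G x \<equiv> {y. adj G x y}"

text \<open>Rotation in the sense of Posa: the edge from the first vertex to
  \<open>p ! Suc j\<close> replaces the path edge from \<open>p ! j\<close> to
  \<open>p ! Suc j\<close>, and \<open>p ! j\<close> becomes the first vertex.\<close>

lemma path_rotate:
  assumes "path G p" "Suc j < length p" "adj G (hd p) (p ! Suc j)"
  shows "path G (rev (take (Suc j) p) @ drop (Suc j) p)"
proof -
  have p: "p = take (Suc j) p @ drop (Suc j) p" by simp
  have ne: "take (Suc j) p \<noteq> []" "drop (Suc j) p \<noteq> []" using assms(2) by auto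
  have 1: "path G (take (Suc j) p)" "path G (drop (Suc j) p)"
    using assms(1) p ne path_append1[of G "take (Suc j) p"] path_append2[of G "take (Suc j) p"] by metis+
  have 2: "path G (rev (take (Suc j) p))" using 1 path_rev by blast
  have "set (take (Suc j) p) \<inter> set (drop (Suc j) p) = {}"
    using assms(1) unfolding path_def by (meson order_refl set_take_disj_set_drop_if_distinct)
  moreover have "adj G (last (rev (take (Suc j) p))) (hd (drop (Suc j) p))"
    using assms ne by (simp add: last_rev hd_drop_conv_nth)
  ultimately show ?thesis using 1 2 ne
    by (simp add: path_def successively_append_iff)
qed

text \<open>Produces the set \<open>S\<close> to delete: each vertex of \<open>S\<close> starts a
  longest path to \<open>u\<close> obtained by rotation, and \<open>C\<close> is the vertex set
  common to the initial segments of these paths. The edge at \<open>u\<close> ensures that such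
  paths have at least two vertices.\<close>

lemma rotation_set:
  assumes G: "simple_graph G" "finite (verts G)" and u: "adj G u y0"
  obtains S C where "S \<subseteq> C" "C \<subseteq> verts G" "u \<notin> S" "S \<noteq> {}" "C - S \<noteq> {}"
    "\<And>s. s \<in> S \<Longrightarrow> nbrs G s \<subseteq> C" "\<And>s. s \<in> S \<Longrightarrow> card (nbrs G s) \<le> card S"
    "\<And>v. v \<in> C \<Longrightarrow> card C \<le> max_cycle_length G v"
proof -
  have base: "path G [y0, u] \<and> last [y0, u] = u"
    using simple_adjD[OF G(1) u] u by (simp add: path_def adj_commute)
  have "\<exists>p. (path G p \<and> last p = u) \<and> (\<forall>q. path G q \<and> last q = u \<longrightarrow> length q \<le> length p)"
    by (rule ex_has_greatest_nat[of _ "[y0, u]" _ "Suc (card (verts G))"])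
       (use base path_length_le[OF _ G(2)] in \<open>auto simp: less_Suc_eq_le\<close>)
  then obtain pm where pm: "path G pm" "last pm = u"
    and long: "\<And>q. path G q \<Longrightarrow> last q = u \<Longrightarrow> length q \<le> length pm" by blast
  define M where "M = length pm"
  have M2: "2 \<le> M" using long[of "[y0, u]"] base by (simp add: M_def)
  define L where "L p \<longleftrightarrow> path G p \<and> last p = u \<and> length p = M" for p
  have L: "path G p" "last p = u" "length p = M" "p \<noteq> []" "distinct p" "set p \<subseteq> verts G"
    if "L p" for p using that M2 by (auto simp: L_def path_def)
  \<comment> \<open>A neighbour off the path would extend it at the front, contradicting maximal
    length; index 0 is excluded because there are no loops.\<close>
  have nb: "\<exists>i<M. 0 < i \<and> y = p ! i" if p: "L p" and y: "adj G (hd p) y" for p y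
  proof -
    have "y \<in> set p"
    proof (rule ccontr)
      assume "y \<notin> set p"
      then have "path G (y # p)" using L[OF p] y simple_adjD[OF G(1) y]
        by (simp add: path_Cons adj_commute)
      then show False using long[of "y # p"] L[OF p] by (simp add: M_def)
    qed
    then obtain i where i: "i < M" "y = p ! i" using L[OF p] by (metis in_set_conv_nth)
    have "y \<noteq> hd p" using simple_adjD[OF G(1) y] by simp
    then have "i \<noteq> 0" using i L[OF p] by (metis hd_conv_nth)
    then show ?thesis using i by blast
  qed
  \<comment> \<open>A pair consists of a longest path and the index of a neighbour of its first
    vertex. Maximising over all pairs makes \<open>K\<close> a bound for every longest path, not
    only for \<open>p0\<close>.\<close>
  define Q where "Q x \<longleftrightarrow> L (fst x) \<and> snd x < M \<and> adj G (hd (fst x)) (fst x ! snd x)" for x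
  have "Q (pm, 1)"
  proof -
    obtain a b q where "pm = a # b # q" using M2
      by (metis M_def Suc_le_length_iff numeral_2_eq_2)
    then show ?thesis using pm M2 by (auto simp: Q_def L_def M_def path_def)
  qed
  then have "\<exists>x. Q x \<and> (\<forall>y. Q y \<longrightarrow> snd y \<le> snd x)"
    by (rule ex_has_greatest_nat[of Q _ snd M]) (auto simp: Q_def)
  then obtain p0 K where p0: "L p0" "K < M" "adj G (hd p0) (p0 ! K)"
    and far': "\<And>y. Q y \<Longrightarrow> snd y \<le> K" unfolding Q_def by auto
  have far: "i \<le> K" if "L p" "i < M" "adj G (hd p) (p ! i)" for p i
    using far'[of "(p, i)"] that by (simp add: Q_def)
  have K1: "1 \<le> K" using far'[of "(pm, 1)"] \<open>Q (pm, 1)\<close> by simp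
  define C where "C = set (take (Suc K) p0)"
  have cardC: "card C = Suc K" unfolding C_def
    using L[OF p0(1)] p0(2) by (simp add: distinct_card)
  \<comment> \<open>Only the set of the first \<open>Suc K\<close> vertices is fixed, not their
    order, so \<open>A\<close> survives rotations inside \<open>C\<close>.\<close>
  define A where "A p \<longleftrightarrow> L p \<and> set (take (Suc K) p) = C" for p
  have "\<exists>p. A p \<and> (\<forall>q. A q \<longrightarrow> card (nbrs G (hd q)) \<le> card (nbrs G (hd p)))"
  proof (rule ex_has_greatest_nat[of A p0 _ "Suc (card (verts G))"])
    show "A p0" using p0 by (simp add: A_def C_def)
    show "\<forall>y. A y \<longrightarrow> card (nbrs G (hd y)) < Suc (card (verts G))"
      using G simple_adjD[OF G(1)] by (auto simp: less_Suc_eq_le intro!: card_mono)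
  qed
  then obtain p where A: "A p"
    and deg: "\<And>q. A q \<Longrightarrow> card (nbrs G (hd q)) \<le> card (nbrs G (hd p))" by blast
  note Lp = A[unfolded A_def, THEN conjunct1] and Cp = A[unfolded A_def, THEN conjunct2]
  \<comment> \<open>The indices just before neighbours of the first vertex, that is, the places
    where a rotation is possible.\<close>
  define J where "J = {j. Suc j < M \<and> adj G (hd p) (p ! Suc j)}"
  define S where "S = (!) p ` J"
  have JK: "j < K" if "j \<in> J" for j using that far[OF Lp, of "Suc j"] by (auto simp: J_def)
  have "inj_on ((!) p) J" using L[OF Lp] by (auto simp: J_def inj_on_def nth_eq_iff_index_eq)
  then have "card S = card J" unfolding S_def by (rule card_image)
  also have "\<dots> = card (nbrs G (hd p))"
  proof -
    have "inj_on (\<lambda>j. p ! Suc j) J" using L[OF Lp] by (auto simp: J_def inj_on_def nth_eq_iff_index_eq)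
    moreover have "nbrs G (hd p) = (\<lambda>j. p ! Suc j) ` J"
    proof (intro equalityI subsetI)
      fix y assume "y \<in> nbrs G (hd p)"
      then obtain i where "i < M" "0 < i" "y = p ! i" using nb[OF Lp] by blast
      then show "y \<in> (\<lambda>j. p ! Suc j) ` J" using \<open>y \<in> nbrs G (hd p)\<close>
        by (intro image_eqI[of _ _ "i - 1"]) (auto simp: J_def)
    qed (auto simp: J_def)
    ultimately show ?thesis by (simp add: card_image)
  qed
  finally have cardS: "card S = card (nbrs G (hd p))" .
  \<comment> \<open>The rotation reverses a prefix that ends before index \<open>K\<close>, hence
    permutes \<open>C\<close>. For the rotated path, \<open>far\<close> puts the neighbours of
    \<open>s\<close> into \<open>C\<close>, and the choice of \<open>p\<close> bounds their
    number.\<close>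
  have rot: "nbrs G s \<subseteq> C \<and> card (nbrs G s) \<le> card S" if s: "s \<in> S" for s
  proof -
    obtain j where j: "j \<in> J" "s = p ! j" using s by (auto simp: S_def)
    define q where "q = rev (take (Suc j) p) @ drop (Suc j) p"
    have jM: "Suc j < M" "adj G (hd p) (p ! Suc j)" using j by (auto simp: J_def)
    have "path G q" unfolding q_def using jM L[OF Lp] by (intro path_rotate) auto
    moreover have "last q = u" "length q = M" using L[OF Lp] jM by (auto simp: q_def)
    ultimately have Lq: "L q" by (simp add: L_def)
    have hdq: "hd q = s" using L[OF Lp] jM j(2)
      by (simp add: q_def hd_append hd_rev last_conv_nth min_def)
    have "take (Suc K) q = rev (take (Suc j) p) @ take (K - j) (drop (Suc j) p)"
      using jM L[OF Lp] JK[OF j(1)] by (simp add: q_def min_def)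
    moreover have "take (Suc K) p = take (Suc j) p @ take (K - j) (drop (Suc j) p)"
      using take_add[of "Suc j" "K - j" p] JK[OF j(1)] by simp
    ultimately have Cq: "set (take (Suc K) q) = C" using Cp by simp
    have "nbrs G s \<subseteq> C"
    proof
      fix y assume y: "y \<in> nbrs G s"
      then obtain i where i: "i < M" "y = q ! i" using nb[OF Lq] hdq by blast
      then have "i \<le> K" using far[OF Lq] y hdq by auto
      then show "y \<in> C" using i L(3)[OF Lq] Cq unfolding set_conv_nth by force
    qed
    moreover have "A q" using Lq Cq by (simp add: A_def)
    ultimately show ?thesis using deg[of q] hdq cardS by simp
  qed
  have "S \<subseteq> C"
  proof -
    have "p ! j \<in> set (take (Suc K) p)" if "j < K" for j
      using that L(3)[OF Lp] p0(2) by (auto simp: in_set_conv_nth intro!: exI[of _ j])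
    then show ?thesis using JK Cp by (auto simp: S_def)
  qed
  moreover have "C \<subseteq> verts G" using L(6)[OF p0(1)] set_take_subset[of "Suc K" p0] by (auto simp: C_def)
  moreover have "u \<notin> S"
  proof
    assume "u \<in> S"
    then obtain j where "j \<in> J" "u = p ! j" by (auto simp: S_def)
    moreover have "u = p ! (M - 1)" using L[OF Lp] by (metis last_conv_nth)
    ultimately show False using L[OF Lp] by (auto simp: J_def nth_eq_iff_index_eq)
  qed
  moreover have "S \<noteq> {}"
  proof -
    have "adj G (hd p) (p ! 1)"
    proof -
      obtain a b q where "p = a # b # q" using M2 L(3)[OF Lp]
        by (metis Suc_le_length_iff numeral_2_eq_2)
      then show ?thesis using L(1)[OF Lp] by (auto simp: path_def)
    qed
    then have "0 \<in> J" using M2 by (simp add: J_def)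
    then show ?thesis by (auto simp: S_def)
  qed
  \<comment> \<open>The vertex \<open>p ! K\<close> lies in \<open>C\<close>, while all indices in
    \<open>J\<close> are below \<open>K\<close>.\<close>
  moreover have "C - S \<noteq> {}"
  proof -
    have "p ! K \<in> set (take (Suc K) p)"
      using L(3)[OF Lp] p0(2) by (auto simp: in_set_conv_nth intro!: exI[of _ K])
    moreover have "p ! K \<notin> S"
      using JK L[OF Lp] p0(2) by (force simp: S_def J_def nth_eq_iff_index_eq)
    ultimately show ?thesis using Cp by auto
  qed
  \<comment> \<open>For \<open>K = 1\<close> the set \<open>C\<close> has two vertices and the lower
    bound 2 suffices; otherwise the edge from the first vertex of \<open>p0\<close> to
    \<open>p0 ! K\<close> closes a cycle on \<open>C\<close>.\<close>
  moreover have "card C \<le> max_cycle_length G v" if "v \<in> C" for v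
  proof (cases "K = 1")
    case True
    then show ?thesis using max_cycle_ge2[OF G(2), of v] cardC by simp
  next
    case False
    have "path G (take (Suc K) p0)"
      using L[OF p0(1)] path_append1[of G "take (Suc K) p0" "drop (Suc K) p0"] by simp
    moreover have "adj G (last (take (Suc K) p0)) (hd (take (Suc K) p0))"
    proof -
      have "last (take (Suc K) p0) = p0 ! K"
        using p0(2) L(3,4)[OF p0(1)] by (simp add: take_Suc_conv_app_nth)
      then show ?thesis using p0(3) L(4)[OF p0(1)] by (simp add: adj_commute)
    qed
    ultimately have "cycle G (take (Suc K) p0)"
      using False K1 L(3)[OF p0(1)] p0(2) by (simp add: cycle_def)
    then show ?thesis
      using cycle_length_le[OF G(2), of "take (Suc K) p0" v] that cardC L(3)[OF p0(1)] p0(2)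
      by (simp add: C_def min_def split: if_splits)
  qed
  ultimately show ?thesis using that[of S C] rot by blast
qed

section \<open>Counting the edges at the deleted set\<close>

lemma card_adj_pairs:
  assumes "simple_graph G" "finite (verts G)" "E \<subseteq> edges G"
  shows "card {(a, b). {a, b} \<in> E} = 2 * card E"
proof -
  have fin: "finite E" using finite_edges[OF assms(1,2)] assms(3) finite_subset by blast
  have two: "finite {(a, b). {a, b} = e} \<and> card {(a, b). {a, b} = e} = 2" if "e \<in> E" for e
  proof -
    obtain x y where "e = {x, y}" "x \<noteq> y" using edge_adjE[OF assms(1)] assms(3) \<open>e \<in> E\<close> by blast
    moreover have "{(a, b). {a, b} = {x, y}} = {(x, y), (y, x)}" by (auto simp: doubleton_eq_iff)
    ultimately show ?thesis by simp
  qed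
  have "{(a, b). {a, b} \<in> E} = (\<Union>e\<in>E. {(a, b). {a, b} = e})" by auto
  also have "card \<dots> = (\<Sum>e\<in>E. card {(a, b). {a, b} = e})"
    using fin two by (intro card_UN_disjoint) auto
  finally show ?thesis using two by simp
qed

text \<open>Each edge meeting \<open>S\<close> is counted as two ordered pairs. Pairs starting in
  \<open>S\<close> number at most \<open>card S * card S\<close> by the degree bound; pairs entering
  \<open>S\<close> from outside start in \<open>C - S\<close> and number at most
  \<open>(card C - card S) * card S\<close>. Equality makes both estimates tight.\<close>

lemma removed_edges:
  assumes G: "simple_graph G" "finite (verts G)" and C: "S \<subseteq> C" "C \<subseteq> verts G"
    and N: "\<And>s. s \<in> S \<Longrightarrow> nbrs G s \<subseteq> C" "\<And>s. s \<in> S \<Longrightarrow> card (nbrs G s) \<le> card S"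
  shows "2 * card (edges G) \<le> 2 * card (edges (del_verts G S)) + card S * card C"
    and "2 * card (edges G) = 2 * card (edges (del_verts G S)) + card S * card C \<Longrightarrow>
      (\<forall>s\<in>S. card (nbrs G s) = card S \<and> (\<forall>y\<in>C - S. adj G s y))"
proof -
  define E where "E = {e \<in> edges G. e \<inter> S \<noteq> {}}"
  define X where "X = {(a, b). a \<notin> S \<and> b \<in> S \<and> adj G a b}"
  have fin: "finite C" "finite S" using C finite_subset[OF C(2) G(2)] finite_subset[of S C] by simp_all
  have finN: "finite (nbrs G s)" for s
    by (rule finite_subset[OF _ G(2)]) (use simple_adjD[OF G(1)] in auto)
  have "edges G = edges (del_verts G S) \<union> E" "edges (del_verts G S) \<inter> E = {}"
    by (auto simp: E_def del_verts_def)
  then have cE: "card (edges G) = card (edges (del_verts G S)) + card E"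
    using finite_edges[OF G] by (metis card_Un_disjoint finite_Un)
  have X: "X \<subseteq> (C - S) \<times> S" using N(1) adj_commute by (fastforce simp: X_def)
  have "{(a, b). {a, b} \<in> E} = Sigma S (nbrs G) \<union> X"
    by (auto simp: E_def X_def adj_def)
  moreover have "Sigma S (nbrs G) \<inter> X = {}" by (auto simp: X_def)
  moreover have "finite (Sigma S (nbrs G))" "finite X"
    using fin finN X by (auto intro: finite_subset)
  ultimately have "card {(a, b). {a, b} \<in> E} = card (Sigma S (nbrs G)) + card X"
    by (simp add: card_Un_disjoint)
  moreover have "card {(a, b). {a, b} \<in> E} = 2 * card E"
    by (rule card_adj_pairs[OF G]) (auto simp: E_def)
  moreover have "card (Sigma S (nbrs G)) = (\<Sum>s\<in>S. card (nbrs G s))"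
    using fin finN by (intro card_SigmaI) auto
  ultimately have sum: "2 * card E = (\<Sum>s\<in>S. card (nbrs G s)) + card X" by simp
  have cX: "card ((C - S) \<times> S) = (card C - card S) * card S"
    using fin C by (simp add: card_cartesian_product card_Diff_subset)
  have dX: "card X \<le> (card C - card S) * card S"
    using card_mono[OF _ X] fin cX by simp
  have dS: "(\<Sum>s\<in>S. card (nbrs G s)) \<le> card S * card S"
    using sum_mono[OF N(2), where K = S] by simp
  have CS: "card S \<le> card C" using card_mono[OF fin(1) C(1)] .
  have tot: "card S * card S + (card C - card S) * card S = card S * card C"
    using CS by (metis add_mult_distrib le_add_diff_inverse mult.commute)
  show "2 * card (edges G) \<le> 2 * card (edges (del_verts G S)) + card S * card C"
    using cE sum dX dS tot by linarith
  assume eq: "2 * card (edges G) = 2 * card (edges (del_verts G S)) + card S * card C"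
  have eS: "(\<Sum>s\<in>S. card (nbrs G s)) = (\<Sum>s\<in>S. card S)"
    and eX: "card X = card ((C - S) \<times> S)"
    using eq cE sum dX dS tot cX by simp_all
  have "card (nbrs G s) = card S" if "s \<in> S" for s
    using sum_mono_inv[OF eS N(2) that fin(2)] by simp
  moreover have "X = (C - S) \<times> S" using card_subset_eq[OF _ X eX] fin by simp
  ultimately show "\<forall>s\<in>S. card (nbrs G s) = card S \<and> (\<forall>y\<in>C - S. adj G s y)"
    using adj_commute by (fastforce simp: X_def)
qed

section \<open>Graphs attaining the bound\<close>

text \<open>The shape of the graphs attaining the bound for root \<open>u\<close>: cliques
  \<open>insert w S\<close> are attached one by one at a vertex \<open>w\<close>. The last condition
  exempts \<open>u\<close> because the sum in the bound omits the cycle length of \<open>u\<close>,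
  so equality says nothing about it.\<close>

inductive clique_tree :: "'a \<Rightarrow> 'a sgraph \<Rightarrow> bool" for u where
  single: "simple_graph G \<Longrightarrow> verts G = {u} \<Longrightarrow> clique_tree u G"
| pendant: "simple_graph G \<Longrightarrow> finite (verts G) \<Longrightarrow> clique_tree u (del_verts G S) \<Longrightarrow>
    S \<subseteq> verts G \<Longrightarrow> w \<in> verts G - S \<Longrightarrow> clique G (insert w S) \<Longrightarrow>
    (\<And>s. s \<in> S \<Longrightarrow> nbrs G s \<subseteq> insert w S) \<Longrightarrow>
    (\<And>s. s \<in> S \<Longrightarrow> max_cycle_length G s = Suc (card S)) \<Longrightarrow>
    (\<And>v. v \<in> verts G - S \<Longrightarrow> v \<noteq> u \<Longrightarrow>
      max_cycle_length (del_verts G S) v = max_cycle_length G v) \<Longrightarrow> clique_tree u G"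

lemma clique_tree_root: "clique_tree u G \<Longrightarrow> u \<in> verts G"
  by (induction rule: clique_tree.induct) auto

lemma clique_tree_simple: "clique_tree u G \<Longrightarrow> simple_graph G"
  by (induction rule: clique_tree.induct) auto

lemma clique_tree_reach: "clique_tree u G \<Longrightarrow> v \<in> verts G \<Longrightarrow> (adj G)\<^sup>*\<^sup>* v u"
proof (induction arbitrary: v rule: clique_tree.induct)
  case (pendant G S w)
  have H: "(adj G)\<^sup>*\<^sup>* v u" if "v \<in> verts G - S" for v
    using pendant.IH[of v] that by (auto intro: reach_mono simp: del_verts_def)
  show ?case
  proof (cases "v \<in> S")
    case True
    then have "adj G v w" using pendant.hyps by (auto simp: clique_def)
    then show ?thesis using H pendant.hyps by (meson converse_rtranclp_into_rtranclp)
  qed (use H pendant.prems in auto)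
qed auto

lemma clique_tree_connected:
  assumes "clique_tree u G" shows "connected_graph G"
proof -
  have "(adj G)\<^sup>*\<^sup>* x y" if "x \<in> verts G" "y \<in> verts G" for x y
    using clique_tree_reach[OF assms] that reach_sym by (meson rtranclp_trans)
  then show ?thesis using clique_tree_root[OF assms] by (auto simp: connected_graph_def)
qed

text \<open>Used to show that \<open>C - S\<close> is a single vertex in the equality case. An end
  in the attached set \<open>S\<close> forces \<open>n \<le> Suc (card S)\<close>, and a path can
  run through the whole clique \<open>insert w S\<close>. The root carries no condition, but since
  \<open>y \<noteq> z\<close> at least one end has cycle length at least \<open>n\<close>.\<close>

lemma clique_tree_long_path:
  "clique_tree u G \<Longrightarrow> y \<in> verts G \<Longrightarrow> z \<in> verts G \<Longrightarrow> y \<noteq> z \<Longrightarrow>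
    (y \<noteq> u \<longrightarrow> n \<le> max_cycle_length G y) \<Longrightarrow> (z \<noteq> u \<longrightarrow> n \<le> max_cycle_length G z) \<Longrightarrow>
    \<exists>p. path G p \<and> hd p = y \<and> last p = z \<and> n \<le> length p"
proof (induction arbitrary: y z rule: clique_tree.induct)
  case (pendant G S w)
  let ?H = "del_verts G S"
  have fS: "finite S" using pendant.hyps finite_subset by metis
  have sub: "subgraph ?H G" using subgraph_del_verts pendant.hyps by metis
  have uS: "u \<notin> S" using clique_tree_root[OF pendant.hyps(3)] by simp
  have *: "\<exists>p. path G p \<and> hd p = y \<and> last p = z \<and> n \<le> length p"
    if y: "y \<in> S" and z: "z \<in> verts G" "y \<noteq> z" and n: "y \<noteq> u \<longrightarrow> n \<le> max_cycle_length G y" for y z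
  proof -
    have n: "n \<le> Suc (card S)" using n y uS pendant.hyps(8) by fastforce
    show ?thesis
    proof (cases "z \<in> S")
      case True
      obtain xs where xs: "set xs = insert w S - {y, z}" "distinct xs"
        using finite_distinct_list[of "insert w S - {y, z}"] fS by auto
      define p where "p = y # xs @ [z]"
      have p: "set p = insert w S" "distinct p" using xs True y z by (auto simp: p_def)
      have "path G p" using pendant.hyps(6) p by (intro clique_path) (auto simp: p_def)
      moreover have "length p = Suc (card S)"
        using distinct_card[OF p(2)] p(1) fS pendant.hyps(5) by simp
      ultimately show ?thesis using n by (intro exI[of _ p]) (auto simp: p_def)
    next
      case False
      \<comment> \<open>The path first exhausts \<open>S\<close> and then follows \<open>q\<close>
        from \<open>w\<close> to \<open>z\<close>; already its vertices in \<open>S\<close> together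
        with \<open>w\<close> number \<open>Suc (card S)\<close>.\<close>
      have "(adj ?H)\<^sup>*\<^sup>* w z"
        using clique_tree_connected[OF pendant.hyps(3)] False z pendant.hyps(5)
        by (auto simp: connected_graph_def)
      then obtain q where q: "path ?H q" "hd q = w" "last q = z"
        using reach_imp_path[of ?H w z] simple_del_verts pendant.hyps by force
      obtain xs where xs: "set xs = S - {y}" "distinct xs"
        using finite_distinct_list[of "S - {y}"] fS by auto
      define r where "r = y # xs"
      have r: "set r = S" "distinct r" "r \<noteq> []" using xs y by (auto simp: r_def)
      have "path G r" using pendant.hyps(6) r by (intro clique_path) (auto simp: clique_def)
      moreover have "path G q" using path_subgraph q sub by metis
      moreover have "set r \<inter> set q = {}" using q r by (auto simp: path_def)
      moreover have "last r \<in> S" using r by (metis last_in_set)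
      then have "adj G (last r) w" using pendant.hyps(5,6) by (auto simp: clique_def)
      ultimately have "path G (r @ q)" using q(2) by (auto simp: path_def successively_append_iff)
      moreover have "length r = card S" using distinct_card[OF r(2)] r(1) by simp
      moreover have "q \<noteq> []" using q by (auto simp: path_def)
      ultimately show ?thesis using n q
        by (intro exI[of _ "r @ q"]) (cases q; auto simp: r_def)
    qed
  qed
  consider "y \<in> S" | "z \<in> S" "y \<notin> S" | "y \<notin> S" "z \<notin> S" by blast
  then show ?case
  proof cases
    case 1
    then show ?thesis using * pendant.prems by blast
  next
    case 2
    then obtain p where p: "path G p" "hd p = z" "last p = y" "n \<le> length p"
      using *[of z y] pendant.prems by metis
    then have "p \<noteq> []" by (auto simp: path_def)
    then show ?thesis using p by (intro exI[of _ "rev p"]) (auto simp: path_rev hd_rev last_rev)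
  next
    case 3
    then have "\<exists>p. path ?H p \<and> hd p = y \<and> last p = z \<and> n \<le> length p"
      using pendant.prems pendant.hyps(9) by (intro pendant.IH) auto
    then show ?thesis using path_subgraph sub by metis
  qed
qed auto

text \<open>A subgraph meeting \<open>S\<close> and reaching beyond \<open>insert w S\<close> would
  have \<open>w\<close> as a cut vertex, since \<open>S\<close> can be left only through
  \<open>w\<close>.\<close>

lemma clique_tree_nonseparable:
  "clique_tree u G \<Longrightarrow> subgraph B G \<Longrightarrow> nonseparable B \<Longrightarrow> clique G (verts B)"
proof (induction rule: clique_tree.induct)
  case (single G)
  then show ?case by (auto simp: subgraph_def clique_def)
next
  case (pendant G S w)
  let ?H = "del_verts G S"
  have B: "simple_graph B" "verts B \<subseteq> verts G" "edges B \<subseteq> edges G"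
    using pendant.prems by (auto simp: subgraph_def)
  show ?case
  proof (cases "verts B \<inter> S = {}")
    case True
    then have "subgraph B ?H" using B
      by (fastforce simp: subgraph_def del_verts_def simple_graph_def)
    then have "clique ?H (verts B)" using pendant by blast
    then show ?thesis by (auto simp: clique_def adj_del_verts)
  next
    case False
    then obtain x where x: "x \<in> verts B" "x \<in> S" by blast
    have stay: "y \<in> S" if "(adj (del_vertex B w))\<^sup>*\<^sup>* x y" for y
      using that
    proof (induction rule: rtranclp_induct)
      case (step y z)
      then have "adj B y z" "z \<noteq> w" by (auto simp: adj_del_vertex)
      then have "adj G y z" "z \<noteq> w" using B by (auto simp: adj_def)
      then show ?case using pendant.hyps(7)[of y] step by auto
    qed (use x in simp)
    have "verts B \<subseteq> insert w S"
    proof (rule ccontr)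
      assume "\<not> verts B \<subseteq> insert w S"
      then obtain y where y: "y \<in> verts B" "y \<noteq> w" "y \<notin> S" by blast
      have xw: "x \<noteq> w" using x pendant.hyps(5) by auto
      have xy: "(adj B)\<^sup>*\<^sup>* x y" using x y pendant.prems by (auto simp: nonseparable_def connected_graph_def)
      show False
      proof (cases "w \<in> verts B")
        case True
        then have "cut_vertex B w" unfolding cut_vertex_def using x y xw xy stay by blast
        then show False using pendant.prems by (auto simp: nonseparable_def)
      next
        case False
        then have "adj (del_vertex B w) = adj B"
          using simple_adjD[OF B(1)] by (intro ext) (auto simp: adj_del_vertex)
        then show False using xy stay y by simp
      qed
    qed
    then show ?thesis using pendant.hyps(6) B(2) unfolding clique_def by blast
  qed
qed

text \<open>The walk to \<open>u\<close> avoiding \<open>v\<close> marks \<open>y\<close> as a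
  neighbour on the root side. If \<open>v\<close> was attached last, all its neighbours lie in
  \<open>insert w S\<close>, whose order is its cycle length; otherwise \<open>y\<close> and the
  walk survive without \<open>S\<close>. This later makes a parent block at least as large as its
  child.\<close>

lemma clique_tree_towards_root:
  "clique_tree u G \<Longrightarrow> v \<in> verts G \<Longrightarrow> v \<noteq> u \<Longrightarrow> adj G v y \<Longrightarrow>
    (adj (del_vertex G v))\<^sup>*\<^sup>* y u \<Longrightarrow>
    \<exists>K. clique G K \<and> v \<in> K \<and> y \<in> K \<and> max_cycle_length G v \<le> card K"
proof (induction arbitrary: v y rule: clique_tree.induct)
  case (pendant G S w)
  let ?H = "del_verts G S"
  have fS: "finite S" using pendant.hyps finite_subset by metis
  have uS: "u \<notin> S" using clique_tree_root[OF pendant.hyps(3)] by simp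
  show ?case
  proof (cases "v \<in> S")
    case True
    then show ?thesis using pendant.hyps pendant.prems fS
      by (intro exI[of _ "insert w S"]) auto
  next
    case False
    have yS: "y \<notin> S"
    proof
      assume y: "y \<in> S"
      then have vw: "v = w" using pendant.hyps(7)[of y] pendant.prems False by (auto simp: adj_commute[of G v])
      have "z \<in> S" if "(adj (del_vertex G v))\<^sup>*\<^sup>* y z" for z
        using that
      proof (induction rule: rtranclp_induct)
        case (step a b)
        then show ?case using pendant.hyps(7)[of a] vw by (auto simp: adj_del_vertex)
      qed (use y in simp)
      then show False using pendant.prems uS by blast
    qed
    \<comment> \<open>The walk is imitated outside \<open>S\<close> by waiting at \<open>w\<close>
      while the original walk visits \<open>S\<close>.\<close>
    have "(z \<notin> S \<and> (adj (del_vertex ?H v))\<^sup>*\<^sup>* y z) \<or>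
        (z \<in> S \<and> (adj (del_vertex ?H v))\<^sup>*\<^sup>* y w)" if "(adj (del_vertex G v))\<^sup>*\<^sup>* y z" for z
      using that
    proof (induction rule: rtranclp_induct)
      case (step a b)
      have ab: "adj G a b" "a \<noteq> v" "b \<noteq> v" using step by (auto simp: adj_del_vertex)
      consider "a \<notin> S" "b \<notin> S" | "a \<notin> S" "b \<in> S" | "a \<in> S" "b \<in> S" | "a \<in> S" "b \<notin> S" by blast
      then show ?case
      proof cases
        case 1
        then have "adj (del_vertex ?H v) a b" using ab by (simp add: adj_del_vertex adj_del_verts)
        then show ?thesis using 1 step.IH by (auto intro: rtranclp.rtrancl_into_rtrancl)
      next
        case 2
        then have "a = w" using pendant.hyps(7)[of b] ab by (auto simp: adj_commute[of G a])
        then show ?thesis using 2 step.IH by auto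
      next
        case 4
        then have "b = w" using pendant.hyps(7)[of a] ab by auto
        then show ?thesis using 4 step.IH by auto
      qed (use step.IH in auto)
    qed (use yS in auto)
    then have "(adj (del_vertex ?H v))\<^sup>*\<^sup>* y u" using pendant.prems uS by blast
    then obtain K where K: "clique ?H K" "v \<in> K" "y \<in> K" "max_cycle_length ?H v \<le> card K"
      using pendant.IH[of v y] pendant.prems(1-3) False yS by (auto simp: adj_del_verts)
    have "clique G K" using K(1) by (auto simp: clique_def adj_del_verts)
    moreover have "max_cycle_length G v \<le> card K"
      using pendant.hyps(9)[of v] False pendant.prems(1,2) K(4) by simp
    ultimately show ?thesis using K(2,3) by blast
  qed
qed auto

section \<open>The induction for the bound and its equality case\<close>

lemma pendant_clique:
  assumes G: "simple_graph G" "finite (verts G)"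
    and C: "S \<subseteq> C" "C \<subseteq> verts G" "u \<notin> S" "S \<noteq> {}" "C - S \<noteq> {}"
    and N: "\<And>s. s \<in> S \<Longrightarrow> nbrs G s \<subseteq> C" "\<And>v. v \<in> C \<Longrightarrow> card C \<le> max_cycle_length G v"
    and full: "\<And>s. s \<in> S \<Longrightarrow> card (nbrs G s) = card S"
      "\<And>s y. s \<in> S \<Longrightarrow> y \<in> C - S \<Longrightarrow> adj G s y"
    and c: "\<And>s. s \<in> S \<Longrightarrow> max_cycle_length G s = card C"
      "\<And>v. v \<in> verts G - S \<Longrightarrow> v \<noteq> u \<Longrightarrow>
        max_cycle_length (del_verts G S) v = max_cycle_length G v"
    and H: "clique_tree u (del_verts G S)"
  shows "clique_tree u G"
proof -
  let ?H = "del_verts G S"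
  have fin: "finite C" using C(2) G(2) finite_subset by metis
  then have fS: "finite S" using C(1) finite_subset by metis
  obtain s w where s: "s \<in> S" and w: "w \<in> C - S" using C by blast
  have one: "y = w" if y: "y \<in> C - S" for y
  proof (rule ccontr)
    assume "y \<noteq> w"
    \<comment> \<open>Vertices of \<open>C - S\<close> other than \<open>u\<close> keep their cycle
      length when \<open>S\<close> is deleted, which is what the long path needs.\<close>
    moreover have "z \<noteq> u \<longrightarrow> card C \<le> max_cycle_length ?H z" if "z \<in> C - S" for z
      using that c(2)[of z] N(2)[of z] C(2) by auto
    ultimately obtain p where p: "path ?H p" "hd p = y" "last p = w" "card C \<le> length p"
      using clique_tree_long_path[OF H, of y w "card C"] y w C(2) by auto
    have ne: "p \<noteq> []" using p by (auto simp: path_def)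
    have "path G p" using path_subgraph[OF p(1) subgraph_del_verts[OF G(1)]] .
    moreover have "s \<notin> set p" using p(1) s by (auto simp: path_def)
    ultimately have "path G (s # p)" using ne s C full(2)[OF s y] p by (auto simp: path_Cons)
    moreover have "adj G w s" using full(2)[OF s w] by (simp add: adj_commute)
    moreover have "2 \<le> length p"
    proof -
      have "{y, w} \<subseteq> set p" using p ne hd_in_set last_in_set by force
      then have "card {y, w} \<le> length p" by (metis card_length card_mono List.finite_set le_trans)
      then show ?thesis using \<open>y \<noteq> w\<close> by simp
    qed
    ultimately have "cycle G (s # p)" using p ne by (auto simp: cycle_def)
    then have "Suc (length p) \<le> max_cycle_length G s" using cycle_length_le[OF G(2), of "s # p" s] by simp
    then show False using c(1)[OF s] p(4) by simp
  qed
  then have CS: "C = insert w S" using w C(1) by blast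
  have cardC: "card C = Suc (card S)" using CS w fS by auto
  \<comment> \<open>Now that \<open>C\<close> has only one vertex outside \<open>S\<close>, there
    are just \<open>card S\<close> possible neighbours in \<open>C\<close>, and the degree is
    \<open>card S\<close>.\<close>
  have nb: "nbrs G x = C - {x}" if "x \<in> S" for x
  proof (rule card_subset_eq)
    show "nbrs G x \<subseteq> C - {x}" using N(1)[OF that] simple_adjD(3)[OF G(1), of x x] by auto
    show "card (nbrs G x) = card (C - {x})" using full(1)[OF that] that C(1) cardC fin
      by (simp add: card_Diff_singleton subset_iff)
  qed (use fin in simp)
  have "adj G x y" if "x \<in> C" "y \<in> C" "x \<noteq> y" for x y
  proof (cases "x \<in> S")
    case False
    then have "y \<in> S" using that CS by auto
    from nb[OF this] have "x \<in> nbrs G y" using that by simp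
    then show ?thesis by (simp add: adj_commute[of G x])
  next
    case True
    from nb[OF this] have "y \<in> nbrs G x" using that by simp
    then show ?thesis by simp
  qed
  then have "clique G (insert w S)" using C(2) CS by (auto simp: clique_def)
  then show ?thesis using clique_tree.pendant[OF G H _ _ _ _ _ c(2)] C w N(1) c(1) cardC CS by auto
qed

text \<open>The root is arbitrary because the induction needs it: after deleting \<open>S\<close>
  the vertex \<open>u\<close> need not maximise the cycle length, and an isolated root is replaced
  by another vertex.\<close>

lemma rooted_bound:
  assumes "simple_graph G" "finite (verts G)" "u \<in> verts G"
  shows "2 * card (edges G) \<le> (\<Sum>v\<in>verts G - {u}. max_cycle_length G v) \<and>
    (2 * card (edges G) = (\<Sum>v\<in>verts G - {u}. max_cycle_length G v) \<longrightarrow> clique_tree u G)"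
  using assms
proof (induction "card (verts G)" arbitrary: G u rule: less_induct)
  case less
  let ?c = "max_cycle_length"
  note G = less.prems(1,2) and u = less.prems(3)
  have mono: "(\<Sum>v\<in>A. ?c (del_verts G S) v) \<le> (\<Sum>v\<in>A. ?c G v)" for A S
    using max_cycle_mono[OF subgraph_del_verts[OF G(1)] G(2)] by (intro sum_mono)
  show ?case
  proof (cases "\<exists>y. adj G u y")
    case False
    then have noedge: "edges (del_verts G {u}) = edges G"
    proof -
      have "e \<inter> {u} = {}" if e: "e \<in> edges G" for e
      proof (rule ccontr)
        assume "e \<inter> {u} \<noteq> {}"
        moreover obtain x y where "e = {x, y}" "adj G x y" using edge_adjE[OF G(1) e] by metis
        ultimately show False using False adj_commute[of G x y] by auto
      qed
      then show ?thesis by (auto simp: del_verts_def)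
    qed
    show ?thesis
    proof (cases "verts G = {u}")
      case True
      then have "edges G = {}" using edge_adjE[OF G(1)] simple_adjD(1,2)[OF G(1)] False
        by (metis equals0I singletonD)
      then show ?thesis using True clique_tree.single G by auto
    next
      \<comment> \<open>Deleting the isolated \<open>u\<close> loses no edge. The bound at the new
        root \<open>u'\<close> omits the cycle length of \<open>u'\<close>, which is at least 2, so
        the inequality for \<open>u\<close> is strict and equality cannot occur.\<close>
      case other: False
      then obtain u' where u': "u' \<in> verts G - {u}" using u by blast
      have "2 * card (edges G) \<le> (\<Sum>v\<in>verts G - {u} - {u'}. ?c (del_verts G {u}) v)"
        using less.hyps[of "del_verts G {u}" u'] u' G simple_del_verts[OF G(1)] noedge
          card_Diff1_less[OF G(2) u] by simp
      also have "\<dots> \<le> (\<Sum>v\<in>verts G - {u} - {u'}. ?c G v)" by (rule mono)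
      also have "\<dots> < (\<Sum>v\<in>verts G - {u}. ?c G v)"
        using sum.remove[of "verts G - {u}" u' "?c G"] u' G max_cycle_ge2[OF G(2), of u'] by simp
      finally show ?thesis by simp
    qed
  next
    case True
    then obtain y0 where "adj G u y0" by blast
    then obtain S C where C: "S \<subseteq> C" "C \<subseteq> verts G" "u \<notin> S" "S \<noteq> {}" "C - S \<noteq> {}"
      and N: "\<And>s. s \<in> S \<Longrightarrow> nbrs G s \<subseteq> C" "\<And>s. s \<in> S \<Longrightarrow> card (nbrs G s) \<le> card S"
      and cC: "\<And>v. v \<in> C \<Longrightarrow> card C \<le> ?c G v"
      using rotation_set[OF G] by metis
    let ?H = "del_verts G S"
    have SV: "S \<subseteq> verts G" using C by blast
    have fS: "finite S" using SV G(2) finite_subset by metis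
    have "card (verts ?H) < card (verts G)"
      using SV C(4) G(2) by (intro psubset_card_mono) auto
    then have IH: "2 * card (edges ?H) \<le> (\<Sum>v\<in>verts G - S - {u}. ?c ?H v)"
      "2 * card (edges ?H) = (\<Sum>v\<in>verts G - S - {u}. ?c ?H v) \<Longrightarrow> clique_tree u ?H"
      using less.hyps[of ?H u] simple_del_verts[OF G(1)] G u C(3) by auto
    have rem: "2 * card (edges G) \<le> 2 * card (edges ?H) + card S * card C"
      "2 * card (edges G) = 2 * card (edges ?H) + card S * card C \<Longrightarrow>
        (\<forall>s\<in>S. card (nbrs G s) = card S \<and> (\<forall>y\<in>C - S. adj G s y))"
      by (rule removed_edges[OF G C(1,2)]; use N in simp)+
    have split: "(\<Sum>v\<in>verts G - {u}. ?c G v) = (\<Sum>v\<in>verts G - S - {u}. ?c G v) + (\<Sum>v\<in>S. ?c G v)"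
    proof -
      have "verts G - {u} - S = verts G - S - {u}" by auto
      then show ?thesis using sum.subset_diff[of S "verts G - {u}" "?c G"] SV C(3) G(2) by auto
    qed
    have m: "(\<Sum>v\<in>verts G - S - {u}. ?c ?H v) \<le> (\<Sum>v\<in>verts G - S - {u}. ?c G v)" by (rule mono)
    have cS: "(\<Sum>v\<in>S. card C) \<le> (\<Sum>v\<in>S. ?c G v)" using cC C(1) by (intro sum_mono) auto
    then have cS': "card S * card C \<le> (\<Sum>v\<in>S. ?c G v)" by simp
    have bound: "2 * card (edges G) \<le> (\<Sum>v\<in>verts G - {u}. ?c G v)"
      using rem(1) IH(1) split m cS' by linarith
    \<comment> \<open>Equality makes every estimate in the chain tight, and
      \<open>sum_mono_inv\<close> turns equal sums into equal terms.\<close>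
    have "clique_tree u G" if eq: "2 * card (edges G) = (\<Sum>v\<in>verts G - {u}. ?c G v)"
    proof (rule pendant_clique[OF G C N(1) cC])
      have "2 * card (edges G) = 2 * card (edges ?H) + card S * card C"
        using rem(1) IH(1) split m cS' eq by linarith
      from rem(2)[OF this]
      show "card (nbrs G s) = card S" "\<And>y. y \<in> C - S \<Longrightarrow> adj G s y" if "s \<in> S" for s
        using that by auto
      have sum: "(\<Sum>v\<in>S. card C) = (\<Sum>v\<in>S. ?c G v)"
        using rem(1) IH(1) split m cS' eq by simp
      show "?c G s = card C" if "s \<in> S" for s
        using sum_mono_inv[OF sum _ that fS] cC C(1) by (metis subsetD)
      have sum': "(\<Sum>v\<in>verts G - S - {u}. ?c ?H v) = (\<Sum>v\<in>verts G - S - {u}. ?c G v)"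
        using rem(1) IH(1) split m cS' eq by linarith
      show "?c ?H v = ?c G v" if "v \<in> verts G - S" "v \<noteq> u" for v
        by (rule sum_mono_inv[OF sum'])
          (use that G(2) max_cycle_mono[OF subgraph_del_verts[OF G(1)] G(2)] in auto)
      show "clique_tree u ?H"
        using rem(1) IH split m cS' eq by simp
    qed
    then show ?thesis using bound by blast
  qed
qed

section \<open>Blocks\<close>

lemma subgraph_trans: "subgraph A B \<Longrightarrow> subgraph B C \<Longrightarrow> subgraph A C"
  by (auto simp: subgraph_def)

lemma reach_del_mono:
  "(adj (del_vertex A z))\<^sup>*\<^sup>* x y \<Longrightarrow> edges A \<subseteq> edges B \<Longrightarrow> (adj (del_vertex B z))\<^sup>*\<^sup>* x y"
  by (rule reach_mono) (auto simp: del_vertex_def)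

text \<open>A vertex \<open>z\<close> outside \<open>H\<close> is included, where deletion changes
  nothing; later arguments need not ask whether \<open>z\<close> belongs to a block.\<close>

lemma nonseparable_reach:
  assumes "nonseparable H" "simple_graph H" "x \<in> verts H - {z}" "y \<in> verts H - {z}"
  shows "(adj (del_vertex H z))\<^sup>*\<^sup>* x y"
proof (cases "z \<in> verts H")
  case True
  then show ?thesis using assms by (auto simp: nonseparable_def connected_graph_def cut_vertex_def)
next
  case False
  then have "adj (del_vertex H z) = adj H"
    using simple_adjD[OF assms(2)] by (intro ext) (auto simp: adj_del_vertex)
  then show ?thesis using assms by (auto simp: nonseparable_def connected_graph_def)
qed

lemma path_Cons_reach:
  assumes "path G (x # p)" "p \<noteq> []"
  shows "(adj (del_vertex G x))\<^sup>*\<^sup>* (hd p) (last p)"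
proof (rule path_reach[OF _ assms(2)])
  have "successively (adj G) p" "x \<notin> set p" using assms by (auto simp: path_def successively_Cons)
  then show "successively (adj (del_vertex G x)) p"
    by (elim successively_mono) (auto simp: adj_del_vertex)
qed

definition complete_on :: "'a set \<Rightarrow> 'a sgraph" where
  "complete_on K = \<lparr>verts = K, edges = {e. e \<subseteq> K \<and> card e = 2}\<rparr>"

lemma adj_complete_on: "adj (complete_on K) x y \<longleftrightarrow> x \<in> K \<and> y \<in> K \<and> x \<noteq> y"
  by (auto simp: adj_def complete_on_def card_insert_if)

lemma nonseparable_complete_on:
  assumes "K \<noteq> {}" shows "nonseparable (complete_on K)"
proof -
  have "(adj (complete_on K))\<^sup>*\<^sup>* x y" if "x \<in> K" "y \<in> K" for x y
    using that by (cases "x = y") (auto simp: adj_complete_on intro: r_into_rtranclp)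
  moreover have "(adj (del_vertex (complete_on K) v))\<^sup>*\<^sup>* x y"
    if "x \<in> K - {v}" "y \<in> K - {v}" for x y v
    using that by (cases "x = y") (auto simp: adj_del_vertex adj_complete_on intro: r_into_rtranclp)
  ultimately show ?thesis using assms
    by (auto simp: nonseparable_def connected_graph_def cut_vertex_def complete_on_def)
qed

lemma subgraph_complete_on: "clique G K \<Longrightarrow> subgraph (complete_on K) G"
  by (auto simp: subgraph_def clique_def complete_on_def simple_graph_def adj_def card_2_iff)

text \<open>Vertices and edges are counted together because a block is maximal as a graph, not only
  as a vertex set.\<close>

lemma ex_block:
  assumes "simple_graph G" "finite (verts G)" "subgraph H G" "nonseparable H"
  shows "\<exists>B. block G B \<and> subgraph H B"
proof -
  let ?f = "\<lambda>B. card (verts B) + card (edges B)"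
  let ?P = "\<lambda>B. subgraph B G \<and> nonseparable B \<and> subgraph H B"
  have fin: "finite (verts B)" "finite (edges B)" if "subgraph B G" for B
    using that finite_edges[OF assms(1,2)] assms(2) by (auto simp: subgraph_def intro: finite_subset)
  have "\<exists>B. ?P B \<and> (\<forall>B'. ?P B' \<longrightarrow> ?f B' \<le> ?f B)"
  proof (rule ex_has_greatest_nat)
    show "?P H" using assms by (auto simp: subgraph_def)
    have "?f B \<le> ?f G" if "subgraph B G" for B
      using that finite_edges[OF assms(1,2)] assms(2)
      by (auto simp: subgraph_def intro!: add_mono card_mono)
    then show "\<forall>B. ?P B \<longrightarrow> ?f B < Suc (?f G)" by (simp add: less_Suc_eq_le)
  qed
  then obtain B where B: "?P B" and max: "\<And>B'. ?P B' \<Longrightarrow> ?f B' \<le> ?f B" by blast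
  have "B' = B" if B': "subgraph B' G" "nonseparable B'" "subgraph B B'" for B'
  proof -
    have le: "?f B' \<le> ?f B" using max B' B subgraph_trans by blast
    have sub: "verts B \<subseteq> verts B'" "edges B \<subseteq> edges B'" using B'(3) by (auto simp: subgraph_def)
    have "card (verts B) \<le> card (verts B')" "card (edges B) \<le> card (edges B')"
      using sub fin[OF B'(1)] by (auto intro: card_mono)
    then have "card (verts B) = card (verts B')" "card (edges B) = card (edges B')"
      using le by linarith+
    then have "verts B = verts B'" "edges B = edges B'"
      using sub fin[OF B'(1)] card_subset_eq by metis+
    then show ?thesis by simp
  qed
  then show ?thesis using B by (auto simp: block_def)
qed

lemma clique_in_block:
  assumes "simple_graph G" "finite (verts G)" "clique G K" "K \<noteq> {}"
  obtains B where "block G B" "subgraph (complete_on K) B" "K \<subseteq> verts B"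
proof -
  obtain B where "block G B" "subgraph (complete_on K) B"
    using ex_block[OF assms(1,2) subgraph_complete_on nonseparable_complete_on] assms by blast
  moreover from this have "K \<subseteq> verts B" by (simp add: subgraph_def complete_on_def)
  ultimately show ?thesis using that by blast
qed

lemma edge_in_block:
  assumes "simple_graph G" "finite (verts G)" "adj G x y"
  obtains B where "block G B" "x \<in> verts B" "y \<in> verts B" "adj B x y"
proof -
  have "clique G {x, y}" using assms simple_adjD[OF assms(1,3)]
    by (auto simp: clique_def adj_commute)
  then obtain B where "block G B" "subgraph (complete_on {x, y}) B" "{x, y} \<subseteq> verts B"
    using clique_in_block[OF assms(1,2)] by blast
  moreover from this have "adj B x y"
    using simple_adjD[OF assms(1,3)] adj_complete_on[of "{x, y}" x y]
    by (auto simp: subgraph_def adj_def)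
  ultimately show ?thesis using that by blast
qed

lemma vertex_in_block:
  assumes "simple_graph G" "finite (verts G)" "x \<in> verts G"
  obtains B where "block G B" "x \<in> verts B"
  using clique_in_block[OF assms(1,2), of "{x}"] assms(3) by (auto simp: clique_def)

lemma blockD:
  assumes "block G B"
  shows "simple_graph B" "verts B \<subseteq> verts G" "edges B \<subseteq> edges G" "nonseparable B"
    "connected_graph B" "verts B \<noteq> {}"
  using assms by (auto simp: block_def subgraph_def nonseparable_def connected_graph_def)

lemma block_maximal:
  "block G B \<Longrightarrow> subgraph H G \<Longrightarrow> nonseparable H \<Longrightarrow> subgraph B H \<Longrightarrow> H = B"
  by (auto simp: block_def)

text \<open>Otherwise the union of both blocks with a path joining them outside \<open>v\<close> would be
  nonseparable.\<close>

lemma block_eqI: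
  assumes G: "simple_graph G" and B: "block G B" "block G B'"
    and v: "v \<in> verts B" "v \<in> verts B'" and b: "b \<in> verts B - {v}" "b' \<in> verts B' - {v}"
    and reach: "(adj (del_vertex G v))\<^sup>*\<^sup>* b b'"
  shows "B = B'"
proof -
  note B1 = blockD[OF B(1)] and B2 = blockD[OF B(2)]
  obtain p where p: "path (del_vertex G v) p" "hd p = b" "last p = b'"
    using reach_imp_path[OF reach simple_del_vertex[OF G]] b(1) B1(2)
    by (auto simp: del_vertex_def)
  have vp: "v \<notin> set p" and pV: "set p \<subseteq> verts G" using p(1) by (auto simp: path_def del_vertex_def)
  define H where "H = \<lparr>verts = verts B \<union> verts B' \<union> set p,
    edges = edges B \<union> edges B' \<union> {e \<in> edges G. e \<subseteq> set p}\<rparr>"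
  have HV: "verts H = verts B \<union> verts B' \<union> set p" by (simp add: H_def)
  have HE: "edges B \<subseteq> edges H" "edges B' \<subseteq> edges H" by (auto simp: H_def)
  have "edges H \<subseteq> edges G" using B1(3) B2(3) by (auto simp: H_def)
  moreover have "simple_graph H"
    using B1(1) B2(1) G by (auto simp: H_def simple_graph_def)
  moreover have "verts H \<subseteq> verts G" using B1(2) B2(2) pV by (auto simp: HV)
  ultimately have subHG: "subgraph H G" and sH: "simple_graph H" by (simp_all add: subgraph_def)
  have pH: "path H p"
  proof -
    have "successively (\<lambda>x y. adj H x y) p"
    proof (rule successively_mono)
      show "successively (adj (del_vertex G v)) p" using p(1) by (simp add: path_def)
    qed (auto simp: adj_del_vertex, auto simp: adj_def H_def)
    then show ?thesis using p(1) by (auto simp: path_def HV)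
  qed
  \<comment> \<open>After deletion of \<open>z\<close>, a vertex of \<open>p\<close> moves along
    \<open>p\<close> away from \<open>z\<close>, either to \<open>b\<close> or to \<open>b'\<close>
    and then through \<open>B'\<close> to \<open>v\<close>. A vertex of \<open>B'\<close> goes to
    \<open>v\<close>, or, when \<open>v\<close> itself is deleted, to \<open>b'\<close> and back
    along \<open>p\<close>.\<close>
  have to_B: "\<exists>a\<in>verts B - {z}. (adj (del_vertex H z))\<^sup>*\<^sup>* x a" if x: "x \<in> verts H" "x \<noteq> z" for x z
  proof -
    have via: "(adj (del_vertex H z))\<^sup>*\<^sup>* y y'" if "y \<in> verts B' - {z}" "y' \<in> verts B' - {z}" for y y'
      using reach_del_mono[OF nonseparable_reach[OF B2(4,1) that] HE(2)] .
    have on_path: "\<exists>a\<in>verts B - {z}. (adj (del_vertex H z))\<^sup>*\<^sup>* x a"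
      if xp: "x \<in> set p" and xz: "x \<noteq> z" for x
    proof -
      obtain as bs where split: "p = as @ x # bs" using split_list[OF xp] by blast
      have del: "(adj (del_vertex H z))\<^sup>*\<^sup>* (hd q) (last q)" if q: "path H q" "z \<notin> set q" for q
      proof (rule path_reach)
        have "successively (adj H) q" using q by (simp add: path_def)
        then show "successively (adj (del_vertex H z)) q"
          by (rule successively_mono) (use q(2) in \<open>auto simp: adj_del_vertex\<close>)
      qed (use q in \<open>simp add: path_def\<close>)
      show ?thesis
      proof (cases "z \<in> set as")
        case False
        have "path H (as @ [x])" using pH path_append1[of H "as @ [x]" bs] by (simp add: split)
        then have "(adj (del_vertex H z))\<^sup>*\<^sup>* (hd (as @ [x])) x"
          using del[of "as @ [x]"] False xz by simp
        moreover have "hd (as @ [x]) = b" using p(2) by (cases as) (simp_all add: split)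
        moreover have "hd (as @ [x]) \<in> set (as @ [x])" by (rule hd_in_set) simp
        then have "b \<noteq> z" using False xz calculation(2) by auto
        ultimately have "(adj (del_vertex H z))\<^sup>*\<^sup>* b x" "b \<in> verts B - {z}" using b(1) by auto
        from reach_sym[OF this(1)] this(2) show ?thesis by blast
      next
        case True
        then have zp: "z \<notin> set (x # bs)" using pH xz by (auto simp: split path_def)
        have "path H (x # bs)" using pH path_append2[of H as "x # bs"] by (simp add: split)
        then have r: "(adj (del_vertex H z))\<^sup>*\<^sup>* x b'"
          using del[of "x # bs"] zp p(3) by (simp add: split)
        have "b' \<noteq> z" using zp p(3) last_in_set[of "x # bs"] by (auto simp: split)
        moreover have "v \<noteq> z" using vp True by (auto simp: split)
        ultimately have "(adj (del_vertex H z))\<^sup>*\<^sup>* x v"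
          using r via[of b' v] b v by (meson DiffD1 DiffI rtranclp_trans singletonD)
        then show ?thesis using v \<open>v \<noteq> z\<close> by blast
      qed
    qed
    consider "x \<in> verts B" | "x \<in> verts B'" "z \<noteq> v" | "x \<in> verts B'" "z = v" | "x \<in> set p"
      using x HV by blast
    then show ?thesis
    proof cases
      case 2
      then show ?thesis using via[of x v] v x by blast
    next
      case 3
      have "b' \<in> set p" using p by (metis last_in_set path_def)
      then obtain a where "a \<in> verts B - {z}" "(adj (del_vertex H z))\<^sup>*\<^sup>* b' a"
        using on_path[of b'] b(2) 3 by blast
      moreover have "(adj (del_vertex H z))\<^sup>*\<^sup>* x b'" using via[of x b'] 3 x b by blast
      ultimately show ?thesis by (meson rtranclp_trans)
    qed (use x on_path in auto)
  qed
  have conn: "(adj (del_vertex H z))\<^sup>*\<^sup>* x y"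
    if xy: "x \<in> verts H - {z}" "y \<in> verts H - {z}" for x y z
  proof -
    obtain a a' where a: "a \<in> verts B - {z}" "(adj (del_vertex H z))\<^sup>*\<^sup>* x a"
      "a' \<in> verts B - {z}" "(adj (del_vertex H z))\<^sup>*\<^sup>* y a'"
      using to_B[of x z] to_B[of y z] xy by blast
    have "(adj (del_vertex H z))\<^sup>*\<^sup>* a a'"
      using reach_del_mono[OF nonseparable_reach[OF B1(4,1) a(1,3)] HE(1)] .
    then show ?thesis using a(2) reach_sym[OF a(4)] by (meson rtranclp_trans)
  qed
  \<comment> \<open>Deleting \<open>b\<close> reduces connectedness to \<open>conn\<close>; only
    \<open>x = b\<close> needs a walk inside \<open>B\<close>.\<close>
  have "(adj H)\<^sup>*\<^sup>* x v" if x: "x \<in> verts H" for x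
  proof (cases "x = b")
    case True
    then have "(adj B)\<^sup>*\<^sup>* x v" using B1(5) b v by (auto simp: connected_graph_def)
    then show ?thesis by (rule reach_mono[OF _ HE(1)])
  next
    case False
    have "(adj (del_vertex H b))\<^sup>*\<^sup>* x v" using conn[of x b v] x False v b by (auto simp: HV)
    then show ?thesis by (rule reach_mono) (auto simp: del_vertex_def)
  qed
  then have "connected_graph H" unfolding connected_graph_def
    using v HV reach_sym[of H] by (metis UnI1 empty_iff rtranclp_trans)
  then have "nonseparable H" using conn by (auto simp: nonseparable_def cut_vertex_def)
  moreover have "subgraph B H" "subgraph B' H" using B1(1) B2(1) HE by (auto simp: subgraph_def HV)
  ultimately show ?thesis using block_maximal[OF B(1) subHG] block_maximal[OF B(2) subHG] by simp
qed

lemma block_eqI2: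
  assumes "simple_graph G" "block G B" "block G B'" "x \<noteq> y"
    "x \<in> verts B" "y \<in> verts B" "x \<in> verts B'" "y \<in> verts B'"
  shows "B = B'"
  using block_eqI[OF assms(1-3), of x y y] assms by auto

text \<open>Otherwise \<open>B\<close> would be at most the single vertex \<open>v\<close> without
  edges, hence contained in \<open>B'\<close>, contrary to maximality.\<close>

lemma block_other_vertex:
  assumes "block G B" "block G B'" "B \<noteq> B'" "v \<in> verts B'"
  obtains x where "x \<in> verts B - {v}"
proof (cases "verts B \<subseteq> {v}")
  case True
  have "edges B = {}"
  proof (rule ccontr)
    assume "edges B \<noteq> {}"
    then obtain e where "e \<in> edges B" by blast
    then obtain x y where "adj B x y" "x \<noteq> y" using edge_adjE[OF blockD(1)[OF assms(1)]] by metis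
    then show False using simple_adjD[OF blockD(1)[OF assms(1)]] True by (metis singletonD subsetD)
  qed
  then have "subgraph B B'" using True assms(4) blockD[OF assms(1)] by (auto simp: subgraph_def)
  then have "B' = B" using assms(1,2) by (auto simp: block_def)
  then show ?thesis using assms(3) by simp
qed (use that in blast)

text \<open>If the rest of \<open>B\<close> and the rest of \<open>B'\<close> stayed connected
  without \<open>v\<close>, then \<open>block_eqI\<close> would identify the two blocks.\<close>

lemma shared_cut_vertex:
  assumes "simple_graph G" "block G B" "block G B'" "B \<noteq> B'" "v \<in> verts B" "v \<in> verts B'"
  shows "cut_vertex G v"
proof -
  obtain x where x: "x \<in> verts B - {v}" using block_other_vertex[OF assms(2-4,6)] .
  obtain y where y: "y \<in> verts B' - {v}" using block_other_vertex[OF assms(3,2) _ assms(5)] assms(4) by metis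
  have "(adj B)\<^sup>*\<^sup>* x v" "(adj B')\<^sup>*\<^sup>* v y"
    using blockD(5)[OF assms(2)] blockD(5)[OF assms(3)] assms x y by (auto simp: connected_graph_def)
  from reach_mono[OF this(1) blockD(3)[OF assms(2)]] reach_mono[OF this(2) blockD(3)[OF assms(3)]]
  have "(adj G)\<^sup>*\<^sup>* x y" by (rule rtranclp_trans)
  moreover have "\<not> (adj (del_vertex G v))\<^sup>*\<^sup>* x y" using block_eqI[OF assms(1-3,5,6) x y] assms(4) by blast
  ultimately show ?thesis using x y blockD(2)[OF assms(2)] blockD(2)[OF assms(3)] assms(5)
    unfolding cut_vertex_def by blast
qed

text \<open>The first edge lies in some block \<open>B'\<close>, and the remaining path returns to
  \<open>B\<close> without \<open>x\<close>; so \<open>block_eqI\<close> gives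
  \<open>B' = B\<close>.\<close>

lemma path_in_block:
  assumes "simple_graph G" "finite (verts G)" "block G B"
  shows "path G (x # p) \<Longrightarrow> x \<in> verts B \<Longrightarrow> last (x # p) \<in> verts B \<Longrightarrow> set p \<subseteq> verts B"
proof (induction p arbitrary: x)
  case (Cons y q)
  have xy: "adj G x y" "x \<notin> set (y # q)" and yq: "path G (y # q)"
    using Cons.prems(1) path_Cons[of "y # q"] by auto
  obtain B' where B': "block G B'" "x \<in> verts B'" "y \<in> verts B'"
    using edge_in_block[OF assms(1,2) xy(1)] by metis
  have "(adj (del_vertex G x))\<^sup>*\<^sup>* y (last (y # q))" using path_Cons_reach[OF Cons.prems(1)] by simp
  then have "(adj (del_vertex G x))\<^sup>*\<^sup>* (last (y # q)) y" by (rule reach_sym)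
  moreover have "last (y # q) \<in> verts B - {x}" "y \<in> verts B' - {x}"
    using Cons.prems(3) xy(2) B' last_in_set[of "y # q"] by force+
  ultimately have "B = B'" using block_eqI[OF assms(1,3) B'(1) Cons.prems(2) B'(2)] by blast
  then show ?case using Cons.IH[OF yq] Cons.prems(3) B' by simp
qed simp

text \<open>The block of the closing edge contains both ends of the remaining path, hence all of
  it.\<close>

lemma cycle_in_block:
  assumes "simple_graph G" "finite (verts G)" "cycle G p"
  obtains B where "block G B" "set p \<subseteq> verts B"
proof -
  obtain x q where p: "p = x # q" using assms(3) by (cases p) (auto simp: cycle_def)
  obtain B where "block G B" "last p \<in> verts B" "x \<in> verts B"
    using edge_in_block[OF assms(1,2), of "last p" x] assms(3) by (auto simp: cycle_def p)
  moreover from this have "set q \<subseteq> verts B"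
    using path_in_block[OF assms(1,2), of B x q] assms(3) by (simp add: cycle_def p)
  ultimately show ?thesis using that by (simp add: p)
qed

lemma cycle_length_block:
  assumes "simple_graph G" "finite (verts G)" "cycle G p"
  obtains B where "block G B" "set p \<subseteq> verts B" "length p \<le> card (verts B)"
proof -
  obtain B where B: "block G B" "set p \<subseteq> verts B" using cycle_in_block[OF assms] .
  have "finite (verts B)" using blockD(2)[OF B(1)] assms(2) finite_subset by metis
  then have "length p \<le> card (verts B)"
    using B(2) assms(3) card_mono distinct_card by (metis cycle_def path_def)
  then show ?thesis using that B by blast
qed

lemma complete_block_max_cycle:
  assumes "finite (verts G)" "block G B" "complete_graph B" "v \<in> verts B"
  shows "card (verts B) \<le> max_cycle_length G v"
proof (cases "3 \<le> card (verts B)")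
  case True
  have "clique G (verts B)" using assms(3) blockD[OF assms(2)]
    by (auto simp: clique_def complete_graph_def adj_def)
  then show ?thesis using clique_max_cycle assms True by metis
qed (use max_cycle_ge2[OF assms(1), of v] in simp)

lemma card_edges_complete:
  assumes "simple_graph B" "complete_graph B" "finite (verts B)"
  shows "2 * card (edges B) = card (verts B) * (card (verts B) - 1)"
proof -
  have "edges B = {e. e \<subseteq> verts B \<and> card e = 2}"
    using assms(1,2) by (auto simp: simple_graph_def complete_graph_def adj_def card_2_iff)
  then have "card (edges B) = card (verts B) choose 2" using n_subsets[OF assms(3)] by simp
  moreover have "even (card (verts B) * (card (verts B) - 1))"
    by (cases "even (card (verts B))") auto
  ultimately show ?thesis by (simp add: choose_two)
qed

lemma finite_blocks:
  assumes "simple_graph G" "finite (verts G)" shows "finite {B. block G B}"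
proof (rule finite_subset)
  show "{B. block G B} \<subseteq> (\<lambda>(V, E). \<lparr>verts = V, edges = E\<rparr>) ` (Pow (verts G) \<times> Pow (edges G))"
  proof
    fix B assume "B \<in> {B. block G B}"
    then show "B \<in> (\<lambda>(V, E). \<lparr>verts = V, edges = E\<rparr>) ` (Pow (verts G) \<times> Pow (edges G))"
      by (intro image_eqI[of _ _ "(verts B, edges B)"]) (auto dest: blockD)
  qed
qed (use assms finite_edges in auto)

section \<open>The block--cut-vertex tree\<close>

lemma adj_block_tree:
  "adj (block_tree G) a b \<longleftrightarrow> (\<exists>B v. block G B \<and> cut_vertex G v \<and> v \<in> verts B \<and>
    (a = Inl B \<and> b = Inr v \<or> a = Inr v \<and> b = Inl B))"
  by (auto simp: adj_def block_tree_def doubleton_eq_iff)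

lemma simple_block_tree: "simple_graph (block_tree G)"
  by (auto simp: simple_graph_def block_tree_def)

text \<open>Along the tree walk, \<open>p\<close> reaches every vertex other than \<open>v\<close>
  of the current node: blocks stay connected without \<open>v\<close>, and the cut vertices passed
  differ from \<open>v\<close>.\<close>

lemma block_tree_reach:
  assumes B: "block G P" "p \<in> verts P - {v}" and r: "r \<in> verts R - {v}"
    and reach: "(adj (del_vertex (block_tree G) (Inr v)))\<^sup>*\<^sup>* (Inl P) (Inl R)"
  shows "(adj (del_vertex G v))\<^sup>*\<^sup>* p r"
proof -
  have within: "(adj (del_vertex G v))\<^sup>*\<^sup>* x y"
    if "block G B" "x \<in> verts B - {v}" "y \<in> verts B - {v}" for B x y
    using reach_del_mono[OF nonseparable_reach[OF blockD(4,1)[OF that(1)] that(2,3)] blockD(3)[OF that(1)]] .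
  define N where "N a = (case a of Inl B \<Rightarrow> verts B - {v} | Inr w \<Rightarrow> {w})" for a :: "'a sgraph + 'a"
  have "\<forall>y\<in>N a. (adj (del_vertex G v))\<^sup>*\<^sup>* p y"
    if "(adj (del_vertex (block_tree G) (Inr v)))\<^sup>*\<^sup>* (Inl P) a" for a
    using that
  proof (induction rule: rtranclp_induct)
    case base
    then show ?case using within B by (auto simp: N_def)
  next
    case (step a b)
    then obtain B w where B: "block G B" "w \<in> verts B" "w \<noteq> v"
      and ab: "a = Inl B \<and> b = Inr w \<or> a = Inr w \<and> b = Inl B"
      by (auto simp: adj_del_vertex adj_block_tree)
    show ?case
    proof (cases "a = Inr w")
      case True
      then have pw: "(adj (del_vertex G v))\<^sup>*\<^sup>* p w" using step.IH by (simp add: N_def)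
      have "(adj (del_vertex G v))\<^sup>*\<^sup>* p y" if "y \<in> verts B - {v}" for y
        using rtranclp_trans[OF pw within[OF B(1) _ that]] B by simp
      then show ?thesis using True ab by (auto simp: N_def)
    next
      case False
      then show ?thesis using step.IH ab B by (auto simp: N_def)
    qed
  qed
  from this[OF reach] show ?thesis using r by (simp add: N_def)
qed

text \<open>The two tree paths defining a parent are not assumed to fit together. When
  \<open>v\<close> is outside the root, \<open>block_eqI\<close> shows that only one block through
  \<open>v\<close> reaches the root without \<open>v\<close>, so \<open>P\<close> is that block and
  differs from \<open>B\<close>. In the other case \<open>B\<close> meets the root at
  \<open>v\<close>.\<close>

lemma parent_block_separates:
  assumes G: "simple_graph G" and R: "block G R" and P: "parent_block G R B P"
  obtains v where "block G P" "v \<in> verts B" "v \<in> verts P" "P \<noteq> B"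
    "\<And>P' y r. v \<notin> verts R \<Longrightarrow> block G P' \<Longrightarrow> v \<in> verts P' \<Longrightarrow> y \<in> verts P' - {v} \<Longrightarrow>
      r \<in> verts R \<Longrightarrow> (adj (del_vertex G v))\<^sup>*\<^sup>* y r \<Longrightarrow> P' = P" | v where "v \<in> verts R" "v \<in> verts B"
proof -
  let ?T = "block_tree G"
  obtain v p q where p: "path ?T (Inl B # Inr v # p)" "last (Inl B # Inr v # p) = Inl R"
    and q: "path ?T (Inr v # Inl P # q)" "last (Inr v # Inl P # q) = Inl R"
    using P by (auto simp: parent_block_def tree_parent_def)
  have Bv: "block G B" "v \<in> verts B"
    using p(1) by (auto simp: path_Cons adj_block_tree)
  show ?thesis
  proof (cases "v \<in> verts R")
    case False
    \<comment> \<open>The block \<open>P2\<close> following \<open>v\<close> on the path from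
      \<open>B\<close> differs from \<open>B\<close> because a path repeats no node.\<close>
    obtain b p' where p': "p = b # p'" using p(2) by (cases p) auto
    obtain P2 where b: "b = Inl P2" "block G P2" "v \<in> verts P2"
      using p(1) by (auto simp: p' path_Cons adj_block_tree)
    have P2B: "P2 \<noteq> B" using p(1) by (auto simp: p' b path_def)
    have Pv: "block G P" "v \<in> verts P"
      using q(1) by (auto simp: path_Cons adj_block_tree)
    have "path ?T (Inr v # Inl P2 # p')" using p(1) by (simp add: p' b path_Cons)
    then have r2: "(adj (del_vertex ?T (Inr v)))\<^sup>*\<^sup>* (Inl P2) (Inl R)"
      using path_Cons_reach[of ?T "Inr v" "Inl P2 # p'"] p(2) by (simp add: p' b)
    have r1: "(adj (del_vertex ?T (Inr v)))\<^sup>*\<^sup>* (Inl P) (Inl R)"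
      using path_Cons_reach[OF q(1)] q(2) by simp
    have uniq: "P1 = P2" if P1: "block G P1" "v \<in> verts P1" "y \<in> verts P1 - {v}" "r \<in> verts R"
      "(adj (del_vertex G v))\<^sup>*\<^sup>* y r" for P1 y r
    proof -
      obtain z where z: "z \<in> verts P2 - {v}" using block_other_vertex[OF b(2) Bv(1) P2B Bv(2)] .
      have "(adj (del_vertex G v))\<^sup>*\<^sup>* z r"
        using block_tree_reach[OF b(2) z _ r2, of r] P1(4) False by auto
      then have "(adj (del_vertex G v))\<^sup>*\<^sup>* y z" using rtranclp_trans[OF P1(5) reach_sym] by blast
      then show ?thesis using block_eqI[OF G P1(1) b(2) P1(2) b(3) P1(3) z] by blast
    qed
    \<comment> \<open>As \<open>P = B\<close> is not yet excluded, \<open>P2\<close> serves as the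
      second block through \<open>v\<close> in that case.\<close>
    obtain z where z: "z \<in> verts P - {v}"
    proof (cases "P = B")
      case True
      then show ?thesis using block_other_vertex[OF Pv(1) b(2) _ b(3)] P2B that by metis
    qed (use block_other_vertex[OF Pv(1) Bv(1) _ Bv(2)] that in metis)
    obtain r where r: "r \<in> verts R" using blockD(6)[OF R] by blast
    have "P = P2" using uniq[OF Pv z r] block_tree_reach[OF Pv(1) z _ r1, of r] r False by auto
    then show ?thesis using that(1)[OF Pv(1) Bv(2) Pv(2)] P2B uniq by blast
  next
    case True
    from that(2)[OF this Bv(2)] show ?thesis .
  qed
qed

section \<open>Adding blocks in order of decreasing size\<close>

lemma last_exit:
  assumes "r\<^sup>*\<^sup>* x z" "x \<in> U" "z \<notin> U"
  obtains x' y where "x' \<in> U" "y \<notin> U" "r x' y" "(\<lambda>a b. r a b \<and> a \<notin> U \<and> b \<notin> U)\<^sup>*\<^sup>* y z"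
proof -
  have "\<exists>x' y. x' \<in> U \<and> y \<notin> U \<and> r x' y \<and> (\<lambda>a b. r a b \<and> a \<notin> U \<and> b \<notin> U)\<^sup>*\<^sup>* y z"
    using assms
  proof (induction rule: rtranclp_induct)
    case (step y z)
    show ?case
    proof (cases "y \<in> U")
      case True
      then show ?thesis using step by blast
    next
      case False
      then obtain x' y' where "x' \<in> U" "y' \<notin> U" "r x' y'"
        "(\<lambda>a b. r a b \<and> a \<notin> U \<and> b \<notin> U)\<^sup>*\<^sup>* y' y" using step by blast
      moreover have "r y z \<and> y \<notin> U \<and> z \<notin> U" using step False by blast
      ultimately show ?thesis by (metis (no_types, lifting) rtranclp.rtrancl_into_rtrancl)
    qed
  qed simp
  then show ?thesis using that by blast
qed

text \<open>Let \<open>U\<close> be the union of all largest blocks outside \<open>F\<close>. If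
  none of them meets a block of \<open>F\<close>, a walk to the root leaves \<open>U\<close> for the
  last time from a block \<open>B1\<close>. The parent of \<open>B1\<close> shares a vertex with it
  and is at least as large, so it lies in \<open>U\<close> as well; but it is on the root side,
  where the walk has already left \<open>U\<close>.\<close>

lemma ex_next_block:
  assumes G: "simple_graph G" "finite (verts G)" "connected_graph G"
    and R: "block G R" "R \<in> F"
    and F: "\<exists>B. block G B \<and> B \<notin> F"
    and dom: "\<And>B. block G B \<Longrightarrow> B \<noteq> R \<Longrightarrow>
      \<exists>P. parent_block G R B P \<and> card (verts B) \<le> card (verts P)"
  shows "\<exists>B. block G B \<and> B \<notin> F \<and> (\<forall>B'. block G B' \<and> B' \<notin> F \<longrightarrow> card (verts B') \<le> card (verts B)) \<and>
    verts B \<inter> (\<Union>A\<in>F. verts A) \<noteq> {}"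
proof (rule ccontr)
  assume none: "\<not> ?thesis"
  let ?VF = "\<Union>A\<in>F. verts A"
  have "card (verts B) < Suc (card (verts G))" if "block G B" for B
    using blockD(2)[OF that] G(2) by (simp add: card_mono less_Suc_eq_le)
  then have "\<exists>B. (block G B \<and> B \<notin> F) \<and>
      (\<forall>B'. block G B' \<and> B' \<notin> F \<longrightarrow> card (verts B') \<le> card (verts B))"
    using F ex_has_greatest_nat[of "\<lambda>B. block G B \<and> B \<notin> F" _ "\<lambda>B. card (verts B)"] by blast
  then obtain B0 where B0: "block G B0" "B0 \<notin> F"
    and max: "\<And>B'. block G B' \<Longrightarrow> B' \<notin> F \<Longrightarrow> card (verts B') \<le> card (verts B0)" by blast
  define M where "M = {B. block G B \<and> B \<notin> F \<and> card (verts B) = card (verts B0)}"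
  define U where "U = (\<Union>B\<in>M. verts B)"
  have disj: "verts B \<inter> ?VF = {}" if "B \<in> M" for B
  proof -
    have "block G B" "B \<notin> F" "card (verts B) = card (verts B0)" using that by (auto simp: M_def)
    then show ?thesis using none max by metis
  qed
  obtain x0 where x0: "x0 \<in> verts B0" using blockD(6)[OF B0(1)] by blast
  obtain r where r: "r \<in> verts R" using blockD(6)[OF R(1)] by blast
  have RU: "verts R \<inter> U = {}" using disj R(2) unfolding U_def by blast
  have "x0 \<in> U" using x0 B0 by (auto simp: U_def M_def)
  moreover have "(adj G)\<^sup>*\<^sup>* x0 r"
    using G(3) x0 r blockD(2)[OF B0(1)] blockD(2)[OF R(1)] by (auto simp: connected_graph_def)
  ultimately obtain x y where xy: "x \<in> U" "y \<notin> U" "adj G x y"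
    and yr: "(\<lambda>a b. adj G a b \<and> a \<notin> U \<and> b \<notin> U)\<^sup>*\<^sup>* y r"
    using last_exit[of "adj G" x0 r U] r RU by blast
  have avoid: "(adj (del_vertex G v))\<^sup>*\<^sup>* y r" if "v \<in> U" for v
  proof (rule rtranclp_mono[THEN predicate2D, OF _ yr])
    show "(\<lambda>a b. adj G a b \<and> a \<notin> U \<and> b \<notin> U) \<le> adj (del_vertex G v)"
      using that by (auto simp: adj_del_vertex)
  qed
  obtain B1 where B1: "B1 \<in> M" "x \<in> verts B1" using xy(1) by (auto simp: U_def)
  have B1': "block G B1" "B1 \<notin> F" "B1 \<noteq> R" "card (verts B1) = card (verts B0)"
    using B1 R(2) by (auto simp: M_def)
  obtain P where P: "parent_block G R B1 P" "card (verts B1) \<le> card (verts P)"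
    using dom[OF B1'(1,3)] by blast
  show False
  proof (rule parent_block_separates[OF G(1) R(1) P(1)])
    fix v assume "v \<in> verts R" "v \<in> verts B1"
    then show False using B1(1) RU by (auto simp: U_def)
  next
    fix v
    assume v: "block G P" "v \<in> verts B1" "v \<in> verts P" "P \<noteq> B1"
      and uniq: "\<And>P' y r. v \<notin> verts R \<Longrightarrow> block G P' \<Longrightarrow> v \<in> verts P' \<Longrightarrow> y \<in> verts P' - {v} \<Longrightarrow>
        r \<in> verts R \<Longrightarrow> (adj (del_vertex G v))\<^sup>*\<^sup>* y r \<Longrightarrow> P' = P"
    \<comment> \<open>\<open>B1\<close> is disjoint from the blocks in \<open>F\<close> but shares
      \<open>v\<close> with \<open>P\<close>, so \<open>P\<close> is outside \<open>F\<close>; being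
      at least as large as \<open>B1\<close>, it has maximum order too.\<close>
    have PF: "P \<notin> F" using disj[OF B1(1)] v(2,3) by blast
    then have "P \<in> M" using max[OF v(1) PF] P(2) B1'(4) v(1) by (simp add: M_def)
    then have PU: "verts P \<subseteq> U" by (auto simp: U_def)
    then have vU: "v \<in> U" and vR: "v \<notin> verts R" using v(3) RU by auto
    show False
    \<comment> \<open>If the walk leaves \<open>U\<close> at \<open>v\<close>, the block of its exit
      edge is \<open>P\<close>, so \<open>y\<close> would lie in \<open>U\<close>. Otherwise
      \<open>B1\<close> itself reaches the root without \<open>v\<close> and would equal
      \<open>P\<close>.\<close>
    proof (cases "x = v")
      case True
      obtain B' where B': "block G B'" "x \<in> verts B'" "y \<in> verts B'"
        using edge_in_block[OF G(1,2) xy(3)] by metis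
      have "B' = P" using uniq[OF vR B'(1) _ _ r avoid[OF vU]] B' True xy vU by blast
      then show False using B'(3) PU xy(2) by blast
    next
      case False
      have "adj (del_vertex G v) x y" using xy False vU by (auto simp: adj_del_vertex)
      then have "(adj (del_vertex G v))\<^sup>*\<^sup>* x r" using avoid[OF vU] by (rule converse_rtranclp_into_rtranclp)
      then have "B1 = P" using uniq[OF vR B1'(1) v(2) _ r] B1(2) False by blast
      then show False using v(4) by simp
    qed
  qed
qed

text \<open>A block \<open>B\<close> that meets the earlier ones brings at most
  \<open>card (verts B) - 1\<close> new vertices, each of cycle length at most
  \<open>card (verts B)\<close>; the product is twice its number of edges. The term
  \<open>max 2\<close> serves the one-vertex graph, whose cycle length 2 exceeds its order.\<close>

lemma parent_dominated_bound:
  assumes G: "simple_graph G" "finite (verts G)" and pd: "parent_dominated_block_graph G"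
  obtains R where "block G R"
    "(\<Sum>v\<in>verts G. max_cycle_length G v) \<le> 2 * card (edges G) + max 2 (card (verts R))"
proof -
  let ?c = "max_cycle_length G"
  have conn: "connected_graph G" and compl: "\<And>B. block G B \<Longrightarrow> complete_graph B"
    using pd by (auto simp: parent_dominated_block_graph_def block_graph_def)
  obtain R where R: "block G R"
    and large: "\<And>B. block G B \<Longrightarrow> card (verts B) \<le> card (verts R)"
    and dom: "\<And>B. block G B \<Longrightarrow> B \<noteq> R \<Longrightarrow>
      \<exists>P. parent_block G R B P \<and> card (verts B) \<le> card (verts P)"
    using pd unfolding parent_dominated_block_graph_def by blast
  have fin: "finite (verts B)" "finite (edges B)" if "block G B" for B
    using blockD(2,3)[OF that] G finite_edges[OF G] by (auto intro: finite_subset)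
  have ecard: "2 * card (edges B) = card (verts B) * (card (verts B) - 1)" if "block G B" for B
    using card_edges_complete[OF blockD(1)[OF that] compl[OF that] fin(1)[OF that]] .
  define V where "V F = (\<Union>B\<in>F. verts B)" for F :: "'a sgraph set"
  define E where "E F = (\<Union>B\<in>F. edges B)" for F :: "'a sgraph set"
  have cyc: "?c v \<le> n" if "2 \<le> n" "\<And>B. block G B \<Longrightarrow> v \<in> verts B \<Longrightarrow> card (verts B) \<le> n" for v n
  proof (rule max_cycle_leI[OF G(2) that(1)])
    fix p assume p: "cycle G p" "v \<in> set p"
    obtain B where "block G B" "set p \<subseteq> verts B" "length p \<le> card (verts B)"
      using cycle_length_block[OF G p(1)] .
    then show "length p \<le> n" using that(2)[of B] p(2) by (meson le_trans subsetD)
  qed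
  \<comment> \<open>\<open>F\<close> is the family of blocks added so far; the inequality is the
    claim restricted to their vertices and edges.\<close>
  define \<Phi> where "\<Phi> F \<longleftrightarrow> R \<in> F \<and> F \<subseteq> {B. block G B} \<and>
    (\<Sum>v\<in>V F. ?c v) \<le> 2 * card (E F) + max 2 (card (verts R))" for F
  have finF: "finite F" if "F \<subseteq> {B. block G B}" for F
    using finite_subset[OF that finite_blocks[OF G]] .
  have extend: "\<exists>F'. \<Phi> F' \<and> card F < card F'" if F: "\<Phi> F" "F \<noteq> {B. block G B}" for F
  proof -
    have RF: "R \<in> F" and FB: "F \<subseteq> {B. block G B}" using F(1) by (auto simp: \<Phi>_def)
    then obtain B where B: "block G B" "B \<notin> F" "verts B \<inter> V F \<noteq> {}"
      and max: "\<And>B'. block G B' \<Longrightarrow> B' \<notin> F \<Longrightarrow> card (verts B') \<le> card (verts B)"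
      using ex_next_block[OF G conn R RF _ dom] F(2) unfolding V_def by blast
    obtain v where v: "v \<in> verts B" "v \<in> V F" using B(3) by blast
    define N where "N = verts B - V F"
    have finV: "finite (V F)" "finite (E F)" using finF[OF FB] fin FB by (auto simp: V_def E_def)
    have "N \<subseteq> verts B - {v}" using v by (auto simp: N_def)
    then have "card N \<le> card (verts B - {v})" using fin(1)[OF B(1)] by (intro card_mono) auto
    then have cardN: "card N \<le> card (verts B) - 1" using v(1) by simp
    \<comment> \<open>A new vertex lies in no block of \<open>F\<close>, so every cycle through it
      lies in a block outside \<open>F\<close>, and \<open>B\<close> is largest among these.\<close>
    have "?c x \<le> card (verts B)" if x: "x \<in> N" for x
    proof (rule cyc)
      have "card {x, v} \<le> card (verts B)" using x v fin(1)[OF B(1)] by (intro card_mono) (auto simp: N_def)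
      moreover have "x \<noteq> v" using x v by (auto simp: N_def)
      ultimately show "2 \<le> card (verts B)" by simp
      fix B' assume "block G B'" "x \<in> verts B'"
      moreover from this have "B' \<notin> F" using x by (auto simp: N_def V_def)
      ultimately show "card (verts B') \<le> card (verts B)" using max by blast
    qed
    then have "(\<Sum>x\<in>N. ?c x) \<le> card N * card (verts B)" using sum_bounded_above[of N ?c] by simp
    also have "\<dots> \<le> (card (verts B) - 1) * card (verts B)" using cardN by (rule mult_le_mono1)
    also have "\<dots> = 2 * card (edges B)" using ecard[OF B(1)] by (simp add: mult.commute)
    finally have cN: "(\<Sum>x\<in>N. ?c x) \<le> 2 * card (edges B)" .
    \<comment> \<open>Blocks sharing two vertices coincide, so distinct blocks have no common
      edge.\<close>
    have "E F \<inter> edges B = {}"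
    proof (rule ccontr)
      assume "E F \<inter> edges B \<noteq> {}"
      then obtain e A where A: "A \<in> F" "e \<in> edges A" "e \<in> edges B" by (auto simp: E_def)
      obtain x y where e: "e = {x, y}" "x \<noteq> y" "adj B x y" using edge_adjE[OF blockD(1)[OF B(1)] A(3)] .
      have "adj A x y" using e A(2) by (simp add: adj_def)
      moreover have bA: "block G A" using A(1) FB by blast
      ultimately have "A = B" using block_eqI2[OF G(1) bA B(1) e(2)] e(3)
        simple_adjD[OF blockD(1)[OF bA]] simple_adjD[OF blockD(1)[OF B(1)]] by metis
      then show False using A(1) B(2) by simp
    qed
    then have cE: "card (E (insert B F)) = card (E F) + card (edges B)"
      using card_Un_disjoint[OF finV(2) fin(2)[OF B(1)]] by (simp add: E_def Un_commute)
    have VN: "V (insert B F) = V F \<union> N" "V F \<inter> N = {}" by (auto simp: V_def N_def)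
    have finN: "finite N" using fin(1)[OF B(1)] by (simp add: N_def)
    have "(\<Sum>x\<in>V (insert B F). ?c x) = (\<Sum>x\<in>V F. ?c x) + (\<Sum>x\<in>N. ?c x)"
      unfolding VN(1) by (rule sum.union_disjoint[OF finV(1) finN VN(2)])
    then have "\<Phi> (insert B F)" using F(1) cN cE FB B(1) by (simp add: \<Phi>_def)
    moreover have "card F < card (insert B F)" using B(2) finF[OF FB] by simp
    ultimately show ?thesis by blast
  qed
  have "(\<Sum>v\<in>verts R. ?c v) \<le> 2 * card (edges R) + max 2 (card (verts R))"
  proof (cases "2 \<le> card (verts R)")
    case True
    have "(\<Sum>v\<in>verts R. ?c v) \<le> card (verts R) * card (verts R)"
      using sum_bounded_above[of "verts R" ?c] cyc[OF True large] by simp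
    also have "\<dots> = 2 * card (edges R) + card (verts R)"
      using ecard[OF R] True by (cases "card (verts R)") auto
    finally show ?thesis by simp
  next
    case False
    have "?c v \<le> 2" for v
    proof (rule cyc)
      fix B assume "block G B"
      from large[OF this] False show "card (verts B) \<le> 2" by linarith
    qed simp
    then have "(\<Sum>v\<in>verts R. ?c v) \<le> card (verts R) * 2"
      using sum_bounded_above[of "verts R" ?c 2] by simp
    then show ?thesis using False by simp
  qed
  then have base: "\<Phi> {R}" using R by (simp add: \<Phi>_def V_def E_def)
  have "card F < Suc (card {B. block G B})" if "\<Phi> F" for F
    using that finite_blocks[OF G] by (simp add: \<Phi>_def card_mono less_Suc_eq_le)
  \<comment> \<open>A largest family satisfying the invariant consists of all blocks, since
    \<open>extend\<close> enlarges any other.\<close>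
  then have "\<exists>F. \<Phi> F \<and> (\<forall>F'. \<Phi> F' \<longrightarrow> card F' \<le> card F)"
    using base ex_has_greatest_nat[of \<Phi> "{R}" card] by blast
  then have "\<Phi> {B. block G B}" using extend by (metis linorder_not_less)
  moreover have "V {B. block G B} = verts G"
  proof
    show "V {B. block G B} \<subseteq> verts G" using blockD(2) by (auto simp: V_def)
    show "verts G \<subseteq> V {B. block G B}"
    proof
      fix x assume "x \<in> verts G"
      then obtain B where "block G B" "x \<in> verts B" using vertex_in_block[OF G] by metis
      then show "x \<in> V {B. block G B}" by (auto simp: V_def)
    qed
  qed
  moreover have "card (E {B. block G B}) \<le> card (edges G)"
    using finite_edges[OF G] blockD(3) by (intro card_mono) (auto simp: E_def)
  ultimately show ?thesis using that[OF R] by (simp add: \<Phi>_def)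
qed

section \<open>From clique trees to parent-dominated block graphs\<close>

lemma block_tree_shared_vertex:
  assumes "simple_graph G" "block G A" "block G A'" "v \<in> verts A" "v \<in> verts A'"
  shows "(adj (block_tree G))\<^sup>*\<^sup>* (Inl A) (Inl A')"
proof (cases "A = A'")
  case False
  then have "cut_vertex G v" using shared_cut_vertex[OF assms(1-3) _ assms(4,5)] by blast
  then have "adj (block_tree G) (Inl A) (Inr v)" "adj (block_tree G) (Inr v) (Inl A')"
    using assms by (auto simp: adj_block_tree)
  then show ?thesis by (meson converse_rtranclp_into_rtranclp r_into_rtranclp)
qed simp

text \<open>A walk in \<open>G\<close> passes through the blocks of its edges, and consecutive ones
  share a vertex, so they are equal or have a common cut vertex.\<close>

lemma block_tree_connected:
  assumes G: "simple_graph G" "finite (verts G)"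
  shows "(adj G)\<^sup>*\<^sup>* x y \<Longrightarrow> block G B \<Longrightarrow> x \<in> verts B \<Longrightarrow> block G B' \<Longrightarrow> y \<in> verts B' \<Longrightarrow>
    (adj (block_tree G))\<^sup>*\<^sup>* (Inl B) (Inl B')"
proof (induction arbitrary: B' rule: rtranclp_induct)
  case base
  then show ?case using block_tree_shared_vertex[OF G(1)] by blast
next
  case (step y z)
  obtain B'' where B'': "block G B''" "y \<in> verts B''" "z \<in> verts B''"
    using edge_in_block[OF G step.hyps(2)] by metis
  have "(adj (block_tree G))\<^sup>*\<^sup>* (Inl B) (Inl B'')" using step.IH step.prems B'' by blast
  also have "(adj (block_tree G))\<^sup>*\<^sup>* (Inl B'') (Inl B')"
    using block_tree_shared_vertex[OF G(1)] step.prems B'' by blast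
  finally show ?case .
qed

text \<open>The root is a largest block through \<open>u\<close>, and it is largest of all because
  \<open>u\<close> maximises the cycle length. Any other block through \<open>u\<close> has it as a
  parent. A block \<open>B\<close> avoiding \<open>u\<close> has a parent at some \<open>v\<close>
  containing the clique towards \<open>u\<close>, whose order is at least the cycle length of
  \<open>v\<close> and so at least the order of \<open>B\<close>.\<close>

lemma clique_tree_parent_dominated:
  assumes ct: "clique_tree u G" and fin: "finite (verts G)"
    and max: "\<And>v. v \<in> verts G \<Longrightarrow> max_cycle_length G v \<le> max_cycle_length G u"
  shows "parent_dominated_block_graph G"
proof -
  let ?c = "max_cycle_length G" and ?T = "block_tree G"
  note G = clique_tree_simple[OF ct] fin and conn = clique_tree_connected[OF ct]
    and u = clique_tree_root[OF ct]
  \<comment> \<open>The vertices of \<open>B\<close> form a clique, and a block containing the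
    complete graph on them contains \<open>B\<close>; by maximality it is \<open>B\<close>.\<close>
  have compl: "complete_graph B" if B: "block G B" for B
  proof -
    have "clique G (verts B)"
      using clique_tree_nonseparable[OF ct _ blockD(4)[OF B]] B by (simp add: block_def)
    from clique_in_block[OF G this blockD(6)[OF B]] obtain B' where B':
      "block G B'" "subgraph (complete_on (verts B)) B'" .
    have "subgraph B (complete_on (verts B))"
      using blockD(1)[OF B] by (auto simp: subgraph_def complete_on_def simple_graph_def)
    then have "B' = B" using B B' subgraph_trans by (auto simp: block_def)
    then show ?thesis using B'(2) by (auto simp: complete_graph_def subgraph_def adj_def complete_on_def card_insert_if)
  qed
  then have bg: "block_graph G" using conn by (simp add: block_graph_def)
  have finB: "finite (verts B)" if "block G B" for B
    using blockD(2)[OF that] fin finite_subset by metis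
  obtain B0 where B0: "block G B0" "u \<in> verts B0" using vertex_in_block[OF G u] .
  have "\<exists>R. (block G R \<and> u \<in> verts R) \<and>
      (\<forall>B. block G B \<and> u \<in> verts B \<longrightarrow> card (verts B) \<le> card (verts R))"
    by (rule ex_has_greatest_nat[of _ B0 _ "Suc (card (verts G))"])
      (use B0 card_mono[OF fin blockD(2)] in \<open>auto simp: less_Suc_eq_le\<close>)
  then obtain R where R: "block G R" "u \<in> verts R"
    and Rmax: "\<And>B. block G B \<Longrightarrow> u \<in> verts B \<Longrightarrow> card (verts B) \<le> card (verts R)" by blast
  have large: "card (verts B) \<le> card (verts R)" if B: "block G B" for B
  \<comment> \<open>The one-vertex graph is treated apart: there the default 2 exceeds the order of
    the only block.\<close>
  proof (cases "verts G = {u}")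
    case True
    then have "card (verts B) \<le> card {u}" using blockD(2)[OF B] by (intro card_mono) auto
    moreover have "card (verts R) \<noteq> 0" using R finB by auto
    ultimately show ?thesis by simp
  next
    case False
    then obtain x where x: "x \<in> verts G" "x \<noteq> u" using u by blast
    then have "(adj G)\<^sup>*\<^sup>* u x" using conn u by (auto simp: connected_graph_def)
    then obtain y where y: "adj G u y" using x(2) by (metis converse_rtranclpE)
    obtain B1 where B1: "block G B1" "u \<in> verts B1" "y \<in> verts B1" using edge_in_block[OF G y] by metis
    have "card {u, y} \<le> card (verts B1)" using B1 finB by (intro card_mono) auto
    then have R2: "2 \<le> card (verts R)" using Rmax[OF B1(1,2)] simple_adjD(3)[OF G(1) y] by simp
    \<comment> \<open>A cycle through \<open>u\<close> lies in a block through \<open>u\<close>, and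
      \<open>R\<close> is largest among these.\<close>
    have cu: "?c u \<le> card (verts R)"
    proof (rule max_cycle_leI[OF fin R2])
      fix p assume p: "cycle G p" "u \<in> set p"
      obtain B where "block G B" "set p \<subseteq> verts B" "length p \<le> card (verts B)"
        using cycle_length_block[OF G p(1)] .
      then show "length p \<le> card (verts R)" using Rmax[of B] p(2) by (meson le_trans subsetD)
    qed
    obtain b where b: "b \<in> verts B" using blockD(6)[OF B] by blast
    have "card (verts B) \<le> ?c b" using complete_block_max_cycle[OF fin B compl[OF B] b] .
    also have "\<dots> \<le> ?c u" using max b blockD(2)[OF B] by blast
    finally show ?thesis using cu by simp
  qed
  have "\<exists>P. parent_block G R B P \<and> card (verts B) \<le> card (verts P)"
    if B: "block G B" "B \<noteq> R" for B
  proof (cases "u \<in> verts B")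
    case True
    have cu: "cut_vertex G u" using shared_cut_vertex[OF G(1) B(1) R(1) B(2) True R(2)] .
    have "{Inl B, Inr u, Inl R} \<subseteq> verts ?T" using cu B R by (auto simp: block_tree_def)
    then have "path ?T [Inl B, Inr u, Inl R]"
      using cu B R True by (auto simp: path_def adj_block_tree)
    moreover from this have "path ?T [Inr u, Inl R]" by (simp add: path_Cons)
    ultimately have "parent_block G R B R" unfolding parent_block_def tree_parent_def
      by (intro exI[of _ u] conjI exI[of _ "[Inl R]"] exI[of _ "[]"]) auto
    then show ?thesis using large[OF B(1)] by blast
  next
    case False
    obtain b where b: "b \<in> verts B" using blockD(6)[OF B(1)] by blast
    have "(adj G)\<^sup>*\<^sup>* b u" using conn u b blockD(2)[OF B(1)] by (auto simp: connected_graph_def)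
    then have "(adj ?T)\<^sup>*\<^sup>* (Inl B) (Inl R)" using block_tree_connected[OF G] B(1) b R by blast
    then obtain p where p: "path ?T p" "hd p = Inl B" "last p = Inl R"
      using reach_imp_path[OF _ simple_block_tree, of G "Inl B"] B(1) by (auto simp: block_tree_def)
    obtain p1 where p1: "p = Inl B # p1" using p(1,2) by (cases p) (auto simp: path_def)
    have "p1 \<noteq> []" using p(3) B(2) p1 by auto
    then obtain a p2 where p2: "p1 = a # p2" by (cases p1) auto
    obtain v where a: "a = Inr v" and v: "v \<in> verts B"
      using p(1) by (auto simp: p1 p2 path_Cons adj_block_tree)
    have "p2 \<noteq> []" using p(3) by (auto simp: p1 p2 a)
    then obtain d p3 where p3: "p2 = d # p3" by (cases p2) auto
    obtain P where d: "d = Inl P" and P: "block G P" "v \<in> verts P"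
      using p(1) by (auto simp: p1 p2 p3 a path_Cons adj_block_tree)
    have pp: "path ?T (Inl B # Inr v # Inl P # p3)" "last (Inl P # p3) = Inl R"
      using p(1,3) by (simp_all add: p1 p2 p3 a d)
    then have PB: "P \<noteq> B" by (auto simp: path_def)
    have pv: "path ?T (Inr v # Inl P # p3)" using pp(1) by (simp add: path_Cons)
    have par: "parent_block G R B P" unfolding parent_block_def tree_parent_def
      using pp pv by (intro exI[of _ v] conjI exI[of _ "Inl P # p3"] exI[of _ p3]) auto
    have vu: "v \<noteq> u" using False v by blast
    have vG: "v \<in> verts G" using v blockD(2)[OF B(1)] by blast
    obtain y where y: "y \<in> verts P - {v}" using block_other_vertex[OF P(1) B(1) PB v] .
    have "(adj (del_vertex ?T (Inr v)))\<^sup>*\<^sup>* (Inl P) (Inl R)"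
      using path_Cons_reach[OF pv] pp(2) by simp
    then have yu: "(adj (del_vertex G v))\<^sup>*\<^sup>* y u" using block_tree_reach[OF P(1) y] R(2) vu by blast
    have vy: "adj G v y" using compl[OF P(1)] P(2) y blockD(3)[OF P(1)]
      by (auto simp: complete_graph_def adj_def)
    obtain K where K: "clique G K" "v \<in> K" "y \<in> K" "?c v \<le> card K"
      using clique_tree_towards_root[OF ct vG vu vy yu] by blast
    obtain P' where P': "block G P'" "K \<subseteq> verts P'" using clique_in_block[OF G K(1)] K(2) by blast
    \<comment> \<open>The block around \<open>K\<close> shares both \<open>v\<close> and
      \<open>y\<close> with the parent \<open>P\<close>.\<close>
    have "P' = P" using block_eqI2[OF G(1) P'(1) P(1), of v y] P' P(2) K y by blast
    then have "card K \<le> card (verts P)" using P' finB by (intro card_mono) auto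
    moreover have "card (verts B) \<le> ?c v" using complete_block_max_cycle[OF fin B(1) compl[OF B(1)] v] .
    ultimately show ?thesis using par K(4) by (meson le_trans)
  qed
  then show ?thesis unfolding parent_dominated_block_graph_def using bg R(1) large by blast
qed

theorem theorem2p2:
  fixes G :: "'a sgraph" and u :: 'a
  assumes "simple_graph G" and "finite (verts G)" and "verts G \<noteq> {}"
    and "u \<in> verts G"
    and "max_cycle_length G u = Max (max_cycle_length G ` verts G)"
  shows "real (card (edges G))
           \<le> (\<Sum>v\<in>verts G. real (max_cycle_length G v) / 2) - real (max_cycle_length G u) / 2
       \<and> (real (card (edges G))
             = (\<Sum>v\<in>verts G. real (max_cycle_length G v) / 2) - real (max_cycle_length G u) / 2
           \<longleftrightarrow> parent_dominated_block_graph G)"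
proof -
  let ?c = "max_cycle_length G"
  let ?s = "\<Sum>v\<in>verts G - {u}. ?c v"
  have max: "?c v \<le> ?c u" if "v \<in> verts G" for v using assms(2,5) that by simp
  have sum: "(\<Sum>v\<in>verts G. ?c v) = ?c u + ?s" using sum.remove[OF assms(2,4)] .
  have "(\<Sum>v\<in>verts G. real (?c v) / 2) = real (\<Sum>v\<in>verts G. ?c v) / 2"
    by (simp add: sum_divide_distrib)
  then have rhs: "(\<Sum>v\<in>verts G. real (?c v) / 2) - real (?c u) / 2 = real ?s / 2"
    unfolding sum by (simp add: add_divide_distrib)
  have bound: "2 * card (edges G) \<le> ?s"
    and eq: "2 * card (edges G) = ?s \<Longrightarrow> clique_tree u G"
    using rooted_bound[OF assms(1,2,4)] by auto
  have "2 * card (edges G) = ?s \<longleftrightarrow> parent_dominated_block_graph G"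
  proof
    assume "2 * card (edges G) = ?s"
    then show "parent_dominated_block_graph G"
      using clique_tree_parent_dominated[OF eq assms(2) max] by blast
  next
    assume pd: "parent_dominated_block_graph G"
    obtain R where R: "block G R" "(\<Sum>v\<in>verts G. ?c v) \<le> 2 * card (edges G) + max 2 (card (verts R))"
      using parent_dominated_bound[OF assms(1,2) pd] .
    obtain r where r: "r \<in> verts R" using blockD(6)[OF R(1)] by blast
    have "card (verts R) \<le> ?c r" using complete_block_max_cycle[OF assms(2) R(1) _ r] pd R(1)
      by (auto simp: parent_dominated_block_graph_def block_graph_def)
    also have "\<dots> \<le> ?c u" using max r blockD(2)[OF R(1)] by blast
    \<comment> \<open>This turns the estimate from \<open>parent_dominated_bound\<close> into the
      inequality opposite to \<open>bound\<close>.\<close>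
    finally have "max 2 (card (verts R)) \<le> ?c u" using max_cycle_ge2[OF assms(2), of u] by simp
    then show "2 * card (edges G) = ?s" using R(2) sum bound by linarith
  qed
  moreover have "real (card (edges G)) \<le> real ?s / 2 \<longleftrightarrow> 2 * card (edges G) \<le> ?s" by linarith
  moreover have "real (card (edges G)) = real ?s / 2 \<longleftrightarrow> 2 * card (edges G) = ?s" by linarith
  ultimately show ?thesis using bound unfolding rhs by simp
qed

end
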